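(* Let $q$ be a prime power, $n \geq 0$ and $0 \leq h \leq n+1$. **Claim 1.** (Case $\rho_1=0$.) For $\mathcal{L}_n^h(r,0,r)$ to be non-empty it is required that $0 \leq r \leq n_1-1$ if $n$ is even, $0 \leq r \leq n_1$ if $n$ is odd, and $r \leq n-h+1$. If these conditions hold, then $$|\mathcal{L}_n^h(r,0,r)| = \begin{cases} 1 & \text{if } r=0,\\ (q-1)q^{r-1} & \text{if } r>0.\end{cases}$$ **Claim 2.** Let $\rho_1 \in \{1,2,\ldots,n_1-1\}$. For $\mathcal{L}_n^h(\rho_1+\pi_1,\rho_1,\pi_1)$ to be non-empty it is required that $0 \leq \pi_1 \leq n_1-\rho_1-1$ if $n$ is even, $0 \leq \pi_1 \leq n_1-\rho_1$ if $n$ is odd, and $\rho_1 \geq h+1$. If these conditions hold, then $$|\mathcal{L}_n^h(\rho_1+\pi_1,\rho_1,\pi_1)| = \begin{cases} (q-1)q^{2\rho_1-h-1} & \text{if } \pi_1=0,\\ (q-1)^2q^{2\rho_1+\pi_1-h-2} & \text{if } \pi_1>0.\end{cases}$$ **Claim 3.** (Case $\rho_1=n_1$, which implies $r=n_1$, $\pi_1 = 0$ and requires $h+1 \leq n_1$.) If $h+1\leq n_1$, then $$|\mathcal{L}_n^h(n_1,n_1,0)| = (q-1)q^{n-h}.$$ **Claim 4.** We have $$|\mathcal{L}_n^h(r)| = \begin{cases} 1 & \text{if } r=0,\\ (q-1)q^{r-1} & \text{if } 1 \leq r \leq \min\{h,n-h+1\},\\ (q^2-1)q^{2r-h-2} &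 \text{if } h+1 \leq r \leq n_1-1,\\ q^{n-h+1}-q^{2n_1-h-2} & \text{if } r=n_1 \text{ and } h+1 \leq n_1,\end{cases}$$ and $\mathcal{L}_n^h(r)$ is empty for all values of $r$ not covered by these cases. **Claim 5.** Let $l,m\geq 1$ with $l+m-2=n$. If $r<\min\{l,m\}$, then $$|\mathcal{H}_{l,m}^h(r)| = \begin{cases} 1 & \text{if } r=0,\\ (q-1)q^{r-1} & \text{if } 1 \leq r \leq \min\{h,n-h+1\},\\ (q^2-1)q^{2r-h-2} & \text{if } h+1 \leq r \leq n_1-1.\end{cases}$$ If $r=\min\{l,m\}$, then $$|\mathcal{H}_{l,m}^h(r)| = \begin{cases} q^{l+m-h-1}-q^{\min\{l,m\}-1} & \text{if } \min\{l,m\}-1 \leq \min\{h,n-h+1\},\\ q^{l+m-h-1}-q^{2\min\{l,m\}-h-2} & \text{if } \min\{l,m\}-1 \geq h+1.\end{cases}$$ For all values of $r$ not covered by these cases $\mathcal{H}_{l,m}^h(r)$ is empty.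
   Context: For an integer $n\ge 0$ put $n_1 := \lfloor \frac{n+2}{2} \rfloor$ and $n_2 := \lfloor \frac{n+3}{2} \rfloor$. For $\boldsymbol{\alpha}=(\alpha_0,\ldots,\alpha_n) \in \mathbb{F}_q^{n+1}$ and $l,m \geq 1$ with $l+m-2 \leq n$, $H_{l,m}(\boldsymbol{\alpha})$ denotes the $l\times m$ Hankel matrix $(\alpha_{i+j-2})_{1\leq i\leq l,\,1\leq j\leq m}$. $\rho(\boldsymbol{\alpha})$ is the largest $l \in \{1,\ldots,n_1\}$ with $\det H_{l,l}(\boldsymbol{\alpha}) \neq 0$, or $0$ if there is no such $l$; and $\pi(\boldsymbol{\alpha}) := \operatorname{rank} H_{n_1,n_2}(\boldsymbol{\alpha}) - \rho(\boldsymbol{\alpha})$. $\mathcal{L}_n^h(r)$ is the set of $\boldsymbol{\alpha}\in\mathbb{F}_q^{n+1}$ with $\operatorname{rank} H_{n_1,n_2}(\boldsymbol{\alpha})=r$ and $\alpha_0=\cdots=\alpha_{h-1}=0$. $\mathcal{L}_n^h(r,\rho_1,\pi_1)$ is the set of $\boldsymbol{\alpha}\in\mathcal{L}_n^h(r)$ with $\rho(\boldsymbol{\alpha})=\rho_1$, $\pi(\boldsymbol{\alpha})=\pi_1$ (so necessarily $r=\rho_1+\pi_1$). $\mathcal{H}_{l,m}^h(r)$ is the set of $l\times m$ Hankel matrices $(\alpha_{i+j-2})$ over $\mathbb{F}_q$ of rank $r$ with $\alpha_0=\cdots=\alpha_{h-1}=0$. *)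

theory Defs
  imports "Jordan_Normal_Form.DL_Rank_Submatrix"
begin

definition n1 :: "nat \<Rightarrow> nat" where
  "n1 n = (n + 2) div 2"

definition n2 :: "nat \<Rightarrow> nat" where
  "n2 n = (n + 3) div 2"

(* A tuple (a_0, ..., a_n) is a vector in carrier_vec (n + 1). Rows and columns are
   numbered from 0, so the entry a_(i+j-2) of the 1-based convention is a $ (i + j) here.
   The definition is meant for 1 <= l, 1 <= m and l + m - 2 <= n, where no index is out of range. *)
definition hankel_mat :: "nat \<Rightarrow> nat \<Rightarrow> 'a vec \<Rightarrow> 'a mat" where
  "hankel_mat l m \<alpha> = mat l m (\<lambda>(i, j). \<alpha> $ (i + j))"

abbreviation mat_rank :: "'a :: field mat \<Rightarrow> nat" where
  "mat_rank A \<equiv> vec_space.rank (dim_row A) A"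

definition hankel_rho :: "nat \<Rightarrow> 'a :: field vec \<Rightarrow> nat" where
  "hankel_rho n \<alpha> =
     (if \<exists>l\<in>{1..n1 n}. det (hankel_mat l l \<alpha>) \<noteq> 0
      then Max {l \<in> {1..n1 n}. det (hankel_mat l l \<alpha>) \<noteq> 0}
      else 0)"

(* The subtraction on nat does not truncate, see hankel_rho_le_rank. *)
definition hankel_pi :: "nat \<Rightarrow> 'a :: field vec \<Rightarrow> nat" where
  "hankel_pi n \<alpha> = mat_rank (hankel_mat (n1 n) (n2 n) \<alpha>) - hankel_rho n \<alpha>"

definition hankel_tuples :: "nat \<Rightarrow> nat \<Rightarrow> nat \<Rightarrow> 'a :: field vec set" where
  "hankel_tuples n h r =
     {\<alpha> \<in> carrier_vec (n + 1).
        mat_rank (hankel_mat (n1 n) (n2 n) \<alpha>) = r \<and> (\<forall>i<h. \<alpha> $ i = 0)}"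

definition hankel_tuples_rho_pi ::
    "nat \<Rightarrow> nat \<Rightarrow> nat \<Rightarrow> nat \<Rightarrow> nat \<Rightarrow> 'a :: field vec set" where
  "hankel_tuples_rho_pi n h r \<rho>\<^sub>1 \<pi>\<^sub>1 =
     {\<alpha> \<in> hankel_tuples n h r. hankel_rho n \<alpha> = \<rho>\<^sub>1 \<and> hankel_pi n \<alpha> = \<pi>\<^sub>1}"

(* An l x m Hankel matrix with l, m >= 1 has l + m - 1 defining entries. *)
definition hankel_mats :: "nat \<Rightarrow> nat \<Rightarrow> nat \<Rightarrow> nat \<Rightarrow> 'a :: field mat set" where
  "hankel_mats l m h r =
     {hankel_mat l m \<alpha> | \<alpha>. \<alpha> \<in> carrier_vec (l + m - 1) \<and>
        mat_rank (hankel_mat l m \<alpha>) = r \<and> (\<forall>i<h. \<alpha> $ i = 0)}"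

lemma hankel_rho_le_rank:
  fixes \<alpha> :: "'a :: field vec"
  shows "hankel_rho n \<alpha> \<le> mat_rank (hankel_mat (n1 n) (n2 n) \<alpha>)"
proof (cases "\<exists>l\<in>{1..n1 n}. det (hankel_mat l l \<alpha>) \<noteq> 0")
  case False
  then show ?thesis by (simp add: hankel_rho_def)
next
  case True
  define S where "S = {l \<in> {1..n1 n}. det (hankel_mat l l \<alpha>) \<noteq> 0}"
  have "Max S \<in> S"
    using True by (intro Max_in) (auto simp: S_def)
  then obtain l where l: "hankel_rho n \<alpha> = l" "l \<le> n1 n" "det (hankel_mat l l \<alpha>) \<noteq> 0"
    using True by (auto simp: hankel_rho_def S_def)
  let ?A = "hankel_mat (n1 n) (n2 n) \<alpha>"
  have A: "?A \<in> carrier_mat (n1 n) (n2 n)" by (simp add: hankel_mat_def)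
  have le: "n1 n \<le> n2 n" by (simp add: n1_def n2_def)
  have card_less: "card {i. i < k \<and> i \<in> {..<l}} = l" if "l \<le> k" for k
  proof -
    have "{i. i < k \<and> i \<in> {..<l}} = {..<l}" using that by auto
    then show ?thesis by simp
  qed
  have pick: "pick {..<l} i = i" if "i < l" for i
  proof -
    have "pick {..<l} (card {a \<in> {..<l}. a < i}) = i"
      using that by (intro pick_card_in_set) auto
    moreover have "{a \<in> {..<l}. a < i} = {..<i}" using that by auto
    ultimately show ?thesis by simp
  qed
  have "submatrix ?A {..<l} {..<l} = hankel_mat l l \<alpha>"
  proof (rule eq_matI)
    fix i j assume ij: "i < dim_row (hankel_mat l l \<alpha>)" "j < dim_col (hankel_mat l l \<alpha>)"
    then have "i < l" "j < l" by (auto simp: hankel_mat_def)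
    then show "submatrix ?A {..<l} {..<l} $$ (i, j) = hankel_mat l l \<alpha> $$ (i, j)"
      using l(2) le A card_less[of "n1 n"] card_less[of "n2 n"]
      by (subst submatrix_index) (auto simp: pick hankel_mat_def)
  qed (use l(2) le A card_less[of "n1 n"] card_less[of "n2 n"]
        in \<open>auto simp: dim_submatrix hankel_mat_def\<close>)
  then have "card {j. j < n2 n \<and> j \<in> {..<l}} \<le> vec_space.rank (n1 n) ?A"
    using l(3) by (intro vec_space.rank_gt_minor[OF A, where I = "{..<l}"]) simp
  then show ?thesis
    using card_less[of "n2 n"] l(1,2) le A by simp
qed

end

theory Submission
  imports Defs "Berlekamp_Zassenhaus.Berlekamp_Type_Based"
begin

text \<open>
  Read a Hankel matrix as a moment matrix. Let \<open>L\<close> be the linear functional on polynomials with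
  \<open>L (x^i) = \<alpha>_i\<close>. A vector in the kernel of the \<open>m \<times> l\<close> Hankel matrix is a polynomial \<open>y\<close> of degree
  less than \<open>l\<close> with \<open>L (x^j y) = 0\<close> for all \<open>j < m\<close>. Over a finite field the size of this set of
  annihilators determines the rank, because kernel and range of a matrix have sizes that multiply to
  \<open>q ^ (number of columns)\<close>.

  Suppose that the leading \<open>\<rho> \<times> \<rho>\<close> Hankel matrix is nonsingular. Then there is a monic \<open>p\<close> of degree
  \<open>\<rho>\<close> that is orthogonal to all polynomials of degree less than \<open>\<rho>\<close>. Its discrepancies
  \<open>d_i = L (x^i p)\<close> vanish for \<open>i < \<rho>\<close>; in general \<open>d_i\<close> is \<open>\<alpha>_(i + \<rho>)\<close> plus a combination of the
  \<open>\<rho>\<close> entries before it, so the discrepancies tell where the tuple leaves the linear recurrence with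
  characteristic polynomial \<open>p\<close>. Division with remainder by \<open>p\<close> shows that the annihilators are the
  multiples \<open>v p\<close> with \<open>v\<close> of small degree, where the bound on the degree depends, for given sizes, only
  on the index \<open>t\<close> of the first nonzero discrepancy (\<open>hankel_annihilators_eq\<close>). Two facts follow. The invariant
  \<open>\<rho>(\<alpha>)\<close> equals \<open>\<rho>\<close> exactly if \<open>d_i = 0\<close> for all \<open>i < n_1\<close>
  (\<open>hankel_rho_eq_iff_discrepancies\<close>). Every \<open>l \<times> m\<close> Hankel matrix with \<open>l + m = n + 2\<close> has rank
  \<open>min l m (n + 1 - t)\<close> (\<open>rank_hankel_mat_first_discrepancy\<close>); hence the almost square one determines
  all the others (\<open>rank_hankel_mat_min\<close>), and for \<open>\<rho>(\<alpha>) < n_1\<close> the number \<open>\<pi>(\<alpha>)\<close> is the number of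
  discrepancies from the first nonzero one to the last one, \<open>d_(n - \<rho>)\<close>.

  For the counting, replace each \<open>\<alpha>_i\<close> with \<open>i \<ge> 2 \<rho>\<close> by \<open>d_(i - \<rho>)\<close>. This map is triangular, hence a
  bijection (\<open>bij_betw_discrepancies\<close>), and it turns "rank at most \<open>r\<close>" into "the entries from \<open>2 \<rho>\<close>
  up to some index vanish". So, for \<open>0 < \<rho> < n_1\<close> and \<open>\<rho> \<le> r \<le> n + 1 - n_1\<close>, there
  are \<open>N_\<rho> q^(r - \<rho>)\<close> tuples with invariant \<open>\<rho>\<close> and rank at most \<open>r\<close>, where \<open>N_\<rho>\<close> counts the prefixes
  of length \<open>2 \<rho>\<close> with \<open>h\<close> leading zeros and nonsingular \<open>\<rho> \<times> \<rho>\<close> Hankel matrix. For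
  \<open>\<rho> = 0\<close> one has \<open>p = 1\<close>, and the tuples are those with enough leading zeros. Summing over \<open>\<rho>\<close>, the
  geometric series telescopes: the number of tuples with \<open>h\<close> leading zeros and rank at most \<open>k < n_1\<close> is
  \<open>q^(2 k - h)\<close> for \<open>k \<ge> h\<close> and \<open>q^(min k (n + 1 - h))\<close> otherwise. The numbers \<open>N_\<rho>\<close> come out of the same
  sum by induction, since a square Hankel matrix of size \<open>\<rho>\<close> is singular exactly if its rank is at most
  \<open>\<rho> - 1\<close>, and these matrices are counted by the smaller invariants (\<open>card_hankel_nonsing\<close>). The
  asserted numbers are differences of these cumulative counts and, for \<open>\<rho> = n_1\<close>, the number of tuples
  with nonsingular leading square matrix of size \<open>n_1\<close>.
\<close>

section \<open>Rank and kernel over a finite field\<close>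

lemma (in vec_space) range_mat_of_cols:
  assumes "set ws \<subseteq> carrier_vec n"
  shows "(\<lambda>v. mat_of_cols n ws *\<^sub>v v) ` carrier_vec (length ws) = span (set ws)"
proof -
  have "\<forall>x \<in> set ws. dim_vec x = n" using assms by auto
  note mult = lincomb_list_as_mat_mult[OF this]
  have vec: "vec (length ws) ((vec_index v)) = v" if "v \<in> carrier_vec (length ws)" for v :: "'a vec"
    using that by auto
  have "span_list ws = (\<lambda>v. mat_of_cols n ws *\<^sub>v v) ` carrier_vec (length ws)"
    unfolding span_list_def mult by (auto simp: image_iff) (metis vec)
  then show ?thesis using span_list_as_span[OF assms] by simp
qed

text \<open>
  A vector of \<open>S\<close> outside the span of \<open>U\<close> could be added to \<open>U\<close> without losing independence, against
  the maximality of \<open>U\<close>.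
\<close>

lemma (in vec_space) span_maximal_lin_indpt:
  assumes S: "S \<subseteq> carrier_vec n"
    and U: "maximal U (\<lambda>T. T \<subseteq> S \<and> lin_indpt T)"
  shows "span U = span S"
proof
  have US: "U \<subseteq> S" and li: "lin_indpt U" using U by (auto simp: maximal_def)
  show "span U \<subseteq> span S" using US by (rule span_is_monotone)
  have "s \<in> span U" if s: "s \<in> S" for s
  proof (rule ccontr)
    assume n: "s \<notin> span U"
    have Uc: "U \<subseteq> carrier_vec n" and sc: "s \<in> carrier_vec n" using S US s by auto
    have "s \<notin> U" using n Uc span_mem by auto
    with lin_dep_iff_in_span[OF Uc li sc] n have "lin_indpt (U \<union> {s})" by simp
    with \<open>s \<notin> U\<close> show False
      using U US s unfolding maximal_def
      by (metis Un_subset_iff empty_subsetI insert_subset sup_ge1 insert_is_Un Un_commute)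
  qed
  then show "span S \<subseteq> span U" using US S by (intro span_subsetI) auto
qed

text \<open>
  The columns of \<open>B\<close> are a maximal independent set of columns of \<open>A\<close>. This replaces the rank, a dimension,
  by a parametrization of the column space, which can be counted over a finite field and composed with
  other matrices.
\<close>

lemma (in vec_space) rank_factorization_inj:
  assumes A: "A \<in> carrier_mat n nc"
  obtains B where "B \<in> carrier_mat n (rank A)" "inj_on (\<lambda>v. B *\<^sub>v v) (carrier_vec (rank A))"
    "(\<lambda>v. B *\<^sub>v v) ` carrier_vec (rank A) = (\<lambda>v. A *\<^sub>v v) ` carrier_vec nc"
proof -
  have cols: "set (cols A) \<subseteq> carrier_vec n" using A cols_dim by blast
  obtain S where S: "maximal S (\<lambda>T. T \<subseteq> set (cols A) \<and> lin_indpt T)"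
    using maximal_exists[of "(\<lambda>T. T \<subseteq> set (cols A) \<and> lin_indpt T)" "card (set (cols A))" "{}"]
    by (meson List.finite_set card_mono empty_iff empty_subsetI finite_lin_indpt2 rev_finite_subset)
  then have Scols: "S \<subseteq> set (cols A)" and li: "lin_indpt S" by (auto simp: maximal_def)
  then obtain ws where ws: "distinct ws" "set ws = S"
    using finite_distinct_list infinite_super by (metis List.finite_set)
  have len: "length ws = rank A"
    using rank_card_indpt[OF A S] distinct_card[OF ws(1)] ws(2) by simp
  define B where "B = mat_of_cols n ws"
  have B: "B \<in> carrier_mat n (rank A)" using len by (auto simp: B_def)
  have colsB: "cols B = ws" using Scols cols ws by (auto simp: B_def)
  have ker: "v = 0\<^sub>v (rank A)" if "v \<in> carrier_vec (rank A)" "B *\<^sub>v v = 0\<^sub>v n" for v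
    using lin_depI[OF B that(1) _ that(2)] li ws colsB by auto
  have inj: "inj_on (\<lambda>v. B *\<^sub>v v) (carrier_vec (rank A))"
  proof
    fix v w assume v: "v \<in> carrier_vec (rank A)" and w: "w \<in> carrier_vec (rank A)"
      and eq: "B *\<^sub>v v = B *\<^sub>v w"
    have "B *\<^sub>v w \<in> carrier_vec n" using B w by auto
    then have "B *\<^sub>v (v - w) = 0\<^sub>v n"
      using mult_minus_distrib_mat_vec[OF B v w] eq by simp
    then have "v - w = 0\<^sub>v (rank A)" using ker v w by auto
    moreover have "v = (v - w) + w" using v w by (intro eq_vecI) auto
    ultimately show "v = w" using w by simp
  qed
  have "(\<lambda>v. B *\<^sub>v v) ` carrier_vec (rank A) = span S"
    using range_mat_of_cols[of ws] Scols cols ws len by (auto simp: B_def)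
  also have "\<dots> = span (set (cols A))"
    by (rule span_maximal_lin_indpt[OF cols S])
  also have "\<dots> = (\<lambda>v. A *\<^sub>v v) ` carrier_vec nc"
    using range_mat_of_cols[OF cols] mat_of_cols_cols[of A] A by auto
  finally show ?thesis using that B inj by blast
qed

lemma card_range_mat:
  fixes A :: "'a :: {field, finite} mat"
  assumes A: "A \<in> carrier_mat n nc"
  shows "card ((\<lambda>v. A *\<^sub>v v) ` carrier_vec nc) = CARD('a) ^ vec_space.rank n A"
proof -
  interpret vec_space "TYPE('a)" n .
  obtain B where "inj_on (\<lambda>v. B *\<^sub>v v) (carrier_vec (rank A))"
    "(\<lambda>v. B *\<^sub>v v) ` carrier_vec (rank A) = (\<lambda>v. A *\<^sub>v v) ` carrier_vec nc"
    using rank_factorization_inj[OF A] by metis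
  then show ?thesis by (metis card_image card_carrier_vec)
qed

text \<open>
  Column rank bounds row rank: expressing the columns of \<open>A\<close> in the \<open>rank A\<close> columns of \<open>B\<close> gives
  \<open>A = B * C\<close>, and then the range of \<open>A\<^sup>T = C\<^sup>T * B\<^sup>T\<close> lies in the range of \<open>C\<^sup>T\<close>, which has only
  \<open>rank A\<close> columns. Comparing the sizes of the two ranges gives the inequality.
\<close>

lemma rank_transpose_le:
  fixes A :: "'a :: {field, finite} mat"
  assumes A: "A \<in> carrier_mat n nc"
  shows "vec_space.rank nc A\<^sup>T \<le> vec_space.rank n A"
proof -
  interpret vec_space "TYPE('a)" n .
  let ?r = "rank A"
  obtain B where B: "B \<in> carrier_mat n ?r"
    and range: "(\<lambda>v. B *\<^sub>v v) ` carrier_vec ?r = (\<lambda>v. A *\<^sub>v v) ` carrier_vec nc"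
    using rank_factorization_inj[OF A] by metis
  have "\<exists>c \<in> carrier_vec ?r. B *\<^sub>v c = col A j" if "j < nc" for j
  proof -
    have "A *\<^sub>v unit_vec nc j = col A j" using A that by (intro eq_vecI) auto
    then have "col A j \<in> (\<lambda>v. A *\<^sub>v v) ` carrier_vec nc"
      by (metis image_eqI unit_vec_carrier)
    then show ?thesis using range by (metis imageE)
  qed
  then obtain c where c: "\<And>j. j < nc \<Longrightarrow> c j \<in> carrier_vec ?r" "\<And>j. j < nc \<Longrightarrow> B *\<^sub>v c j = col A j"
    by metis
  define C where "C = mat_of_cols ?r (map c [0..<nc])"
  have C: "C \<in> carrier_mat ?r nc" by (auto simp: C_def)
  have "col (B * C) j = col A j" if j: "j < nc" for j
    using c[OF j] B C j by (subst col_mult2[OF B C j]) (simp add: C_def)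
  then have "A = B * C"
    using A B C by (intro mat_col_eqI) auto
  then have AT: "A\<^sup>T = C\<^sup>T * B\<^sup>T" using B C by (simp add: transpose_mult)
  have BT: "B\<^sup>T \<in> carrier_mat ?r n" and CT: "C\<^sup>T \<in> carrier_mat nc ?r" using B C by auto
  have "(\<lambda>v. A\<^sup>T *\<^sub>v v) ` carrier_vec n \<subseteq> (\<lambda>v. C\<^sup>T *\<^sub>v v) ` carrier_vec ?r"
  proof
    fix w assume "w \<in> (\<lambda>v. A\<^sup>T *\<^sub>v v) ` carrier_vec n"
    then obtain v where v: "v \<in> carrier_vec n" "w = A\<^sup>T *\<^sub>v v" by auto
    then have "w = C\<^sup>T *\<^sub>v (B\<^sup>T *\<^sub>v v)" using assoc_mult_mat_vec[OF CT BT] AT by simp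
    moreover have "B\<^sup>T *\<^sub>v v \<in> carrier_vec ?r" using BT v by auto
    ultimately show "w \<in> (\<lambda>v. C\<^sup>T *\<^sub>v v) ` carrier_vec ?r" by blast
  qed
  then have "card ((\<lambda>v. A\<^sup>T *\<^sub>v v) ` carrier_vec n) \<le> card (carrier_vec ?r :: 'a vec set)"
    by (meson card_mono card_image_le finite_carrier_vec finite_imageI le_trans)
  then have "CARD('a) ^ vec_space.rank nc A\<^sup>T \<le> CARD('a) ^ ?r"
    using A by (simp add: card_range_mat card_carrier_vec)
  moreover have "1 < CARD('a)"
    using card_mono[of "UNIV :: 'a set" "{0, 1}"] by simp
  ultimately show ?thesis by simp
qed

lemma rank_transpose:
  fixes A :: "'a :: {field, finite} mat"
  assumes A: "A \<in> carrier_mat n nc"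
  shows "vec_space.rank nc A\<^sup>T = vec_space.rank n A"
  using rank_transpose_le[OF A] rank_transpose_le[of "A\<^sup>T" nc n] A by (simp add: antisym)

text \<open>
  Rank-nullity in multiplicative form: every nonempty fibre of \<open>v \<mapsto> A *\<^sub>v v\<close> is a translate of the kernel.
\<close>

lemma card_kernel_times_card_range:
  fixes A :: "'a :: {field, finite} mat"
  assumes A: "A \<in> carrier_mat n nc"
  shows "card (mat_kernel A) * CARD('a) ^ vec_space.rank n A = CARD('a) ^ nc"
proof -
  let ?f = "\<lambda>v. A *\<^sub>v v"
  have fiber: "card {v \<in> carrier_vec nc. ?f v = w} = card (mat_kernel A)"
    if "w \<in> ?f ` carrier_vec nc" for w
  proof -
    from that obtain u where u: "u \<in> carrier_vec nc" "w = ?f u" by auto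
    have fu: "?f u \<in> carrier_vec n" using A u by auto
    have "bij_betw (\<lambda>v. v + u) (mat_kernel A) {v \<in> carrier_vec nc. ?f v = w}"
    proof (rule bij_betw_byWitness[where f' = "\<lambda>v. v - u"])
      show "(\<lambda>v. v + u) ` mat_kernel A \<subseteq> {v \<in> carrier_vec nc. ?f v = w}"
        using u fu by (auto simp: mat_kernel[OF A] mult_add_distrib_mat_vec[OF A])
      show "(\<lambda>v. v - u) ` {v \<in> carrier_vec nc. ?f v = w} \<subseteq> mat_kernel A"
        using u fu by (auto simp: mat_kernel[OF A] mult_minus_distrib_mat_vec[OF A])
    qed (use u in \<open>auto simp: mat_kernel[OF A]\<close>)
    then show ?thesis using bij_betw_same_card by metis
  qed
  have "(CARD('a) ^ nc :: nat) = card (\<Union>w \<in> ?f ` carrier_vec nc. {v \<in> carrier_vec nc. ?f v = w})"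
    by (subst card_carrier_vec[symmetric]) (rule arg_cong[where f = card], auto)
  also have "\<dots> = (\<Sum>w \<in> ?f ` carrier_vec nc. card {v \<in> carrier_vec nc. ?f v = w})"
    by (intro card_UN_disjoint) (auto intro: finite_subset[OF _ finite_carrier_vec[of nc]])
  also have "\<dots> = card (?f ` carrier_vec nc) * card (mat_kernel A)"
    using fiber by simp
  finally show ?thesis using card_range_mat[OF A] by simp
qed

section \<open>Hankel kernels as annihilators of a moment functional\<close>

text \<open>
  The linear functional on polynomials that sends \<open>x^i\<close> to \<open>a i\<close>. It is defined on infinite sequences, so
  that no degree bound has to be carried along; for a vector, \<open>vec_index\<close> supplies unspecified values
  beyond its length, and the conclusions hold whatever these values are.
\<close>

definition moment :: "(nat \<Rightarrow> 'a :: field) \<Rightarrow> 'a poly \<Rightarrow> 'a" where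
  "moment a p = (\<Sum>i\<le>degree p. coeff p i * a i)"

text \<open>
  Degree less than \<open>k\<close>, phrased by coefficients so that the zero polynomial is included for every \<open>k\<close>,
  also for \<open>k = 0\<close>.
\<close>

definition low_degree :: "nat \<Rightarrow> 'a :: field poly set" where
  "low_degree k = {p. \<forall>i\<ge>k. coeff p i = 0}"

text \<open>
  Up to the identification of polynomials with coefficient vectors, the kernel of the Hankel matrix with
  \<open>m\<close> rows and \<open>l\<close> columns: \<open>l\<close> bounds the degree and \<open>m\<close> counts the equations.
\<close>

definition hankel_annihilators :: "(nat \<Rightarrow> 'a :: field) \<Rightarrow> nat \<Rightarrow> nat \<Rightarrow> 'a poly set" where
  "hankel_annihilators a l m = {p \<in> low_degree l. \<forall>j<m. moment a (monom 1 j * p) = 0}"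

lemma low_degree_iff: "p \<in> low_degree k \<longleftrightarrow> p = 0 \<or> degree p < k"
  unfolding low_degree_def
  by (auto intro: coeff_eq_0) (metis leading_coeff_0_iff not_le_imp_less)

lemma moment_eq_sum:
  assumes "p \<in> low_degree N"
  shows "moment a p = (\<Sum>i<N. coeff p i * a i)"
proof (cases "p = 0")
  case False
  then have "degree p < N" using assms by (simp add: low_degree_iff)
  then have "(\<Sum>i<N. coeff p i * a i) = (\<Sum>i\<in>{..degree p}. coeff p i * a i)"
    by (intro sum.mono_neutral_right) (auto simp: coeff_eq_0)
  then show ?thesis by (simp add: moment_def)
qed (simp add: moment_def)

lemma low_degree_mono: "p \<in> low_degree k \<Longrightarrow> k \<le> l \<Longrightarrow> p \<in> low_degree l"
  by (auto simp: low_degree_def)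

lemma low_degree_Suc_degree: "p \<in> low_degree (Suc (degree p))"
  by (simp add: low_degree_iff)

lemma moment_add: "moment a (p + q) = moment a p + moment a q"
proof -
  define N where "N = Suc (max (degree p) (degree q))"
  have "p \<in> low_degree N" "q \<in> low_degree N" by (auto simp: N_def low_degree_iff)
  then show ?thesis
    by (simp add: moment_eq_sum[of _ N] low_degree_def sum.distrib algebra_simps)
qed

lemma moment_smult: "moment a (smult c p) = c * moment a p"
proof -
  have "p \<in> low_degree (Suc (degree p))" by (rule low_degree_Suc_degree)
  then show ?thesis
    by (simp add: moment_eq_sum[of _ "Suc (degree p)"] low_degree_def sum_distrib_left distrib_left mult.assoc)
qed

lemma moment_0 [simp]: "moment a 0 = 0"
  by (simp add: moment_def)

lemma moment_sum: "moment a (\<Sum>i\<in>I. f i) = (\<Sum>i\<in>I. moment a (f i))"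
  by (induction I rule: infinite_finite_induct) (auto simp: moment_add)

text \<open>
  Every moment of a multiple of \<open>p\<close> is a combination of the shifted moments of \<open>p\<close>, with the coefficients
  of the cofactor: this is how information on the discrepancies of \<open>p\<close> enters.
\<close>

lemma moment_mult:
  assumes "v \<in> low_degree N"
  shows "moment a (v * p) = (\<Sum>i<N. coeff v i * moment a (monom 1 i * p))"
proof -
  have "v = (\<Sum>i<N. monom (coeff v i) i)"
    using assms by (intro poly_eqI) (auto simp: coeff_sum low_degree_def not_less)
  then have "v * p = (\<Sum>i<N. monom (coeff v i) i) * p" by (rule arg_cong)
  also have "\<dots> = (\<Sum>i<N. smult (coeff v i) (monom 1 i * p))"
    by (simp add: sum_distrib_right smult_monom flip: mult_smult_left)
  finally show ?thesis by (simp add: moment_sum moment_smult)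
qed

lemma moment_monom: "moment a (monom 1 i) = a i"
  by (subst moment_eq_sum[of _ "Suc i"]) (auto simp: low_degree_iff degree_monom_eq)

lemma moment_monom_mult:
  assumes "p \<in> low_degree N"
  shows "moment a (monom 1 j * p) = (\<Sum>i<N. coeff p i * a (j + i))"
  using moment_mult[OF assms, of a "monom 1 j"]
  by (simp add: mult_monom moment_monom mult.commute add.commute)

lemma poly_of_vec_bij:
  "bij_betw (\<lambda>p. vec k (coeff p)) (low_degree k :: 'a :: field poly set) (carrier_vec k)"
proof (rule bij_betw_byWitness[where f' = "\<lambda>v. \<Sum>i<k. monom (v $ i) i"])
  show "\<forall>p\<in>low_degree k. (\<Sum>i<k. monom (vec k (coeff p) $ i) i) = p"
    by (auto intro!: poly_eqI simp: coeff_sum low_degree_def not_less)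
qed (auto simp: low_degree_def coeff_sum)

lemma card_low_degree: "card (low_degree k :: 'a :: {field, finite} poly set) = CARD('a) ^ k"
  using bij_betw_same_card[OF poly_of_vec_bij[of k, where 'a = 'a]] by (simp add: card_carrier_vec)

lemma hankel_mat_carrier [simp]: "hankel_mat l m \<alpha> \<in> carrier_mat l m"
  and hankel_mat_dim [simp]: "dim_row (hankel_mat l m \<alpha>) = l" "dim_col (hankel_mat l m \<alpha>) = m"
  by (simp_all add: hankel_mat_def)

lemma hankel_kernel_bij:
  "bij_betw (\<lambda>p. vec l (coeff p)) (hankel_annihilators (vec_index \<alpha>) l m)
     (mat_kernel (hankel_mat m l \<alpha>))"
proof -
  have entry: "(hankel_mat m l \<alpha> *\<^sub>v vec l (coeff p)) $ j = moment (vec_index \<alpha>) (monom 1 j * p)"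
    if "p \<in> low_degree l" "j < m" for p j
    unfolding moment_monom_mult[OF that(1)]
    using that by (simp add: hankel_mat_def scalar_prod_def atLeast0LessThan mult.commute)
  have eq: "vec l (coeff p) \<in> mat_kernel (hankel_mat m l \<alpha>)
      \<longleftrightarrow> (\<forall>j<m. moment (vec_index \<alpha>) (monom 1 j * p) = 0)" if p: "p \<in> low_degree l" for p
    unfolding mat_kernel[OF hankel_mat_carrier] vec_eq_iff using entry[OF p] by simp
  have "(\<lambda>p. vec l (coeff p)) ` hankel_annihilators (vec_index \<alpha>) l m
      = mat_kernel (hankel_mat m l \<alpha>)"
  proof (intro equalityI subsetI)
    fix v assume v: "v \<in> mat_kernel (hankel_mat m l \<alpha>)"
    then have "v \<in> carrier_vec l" using mat_kernel_carrier[OF hankel_mat_carrier] by (rule subsetD[rotated])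
    then obtain p where "p \<in> low_degree l" "v = vec l (coeff p)"
      unfolding bij_betw_imp_surj_on[OF poly_of_vec_bij, symmetric] by (rule imageE)
    with v eq show "v \<in> (\<lambda>p. vec l (coeff p)) ` hankel_annihilators (vec_index \<alpha>) l m"
      by (simp add: hankel_annihilators_def)
  qed (use eq in \<open>auto simp: hankel_annihilators_def\<close>)
  moreover have "inj_on (\<lambda>p. vec l (coeff p)) (hankel_annihilators (vec_index \<alpha>) l m)"
    using bij_betw_imp_inj_on[OF poly_of_vec_bij]
    by (rule inj_on_subset) (auto simp: hankel_annihilators_def)
  ultimately show ?thesis by (simp add: bij_betw_def)
qed

lemma zero_mem_hankel_annihilators: "0 \<in> hankel_annihilators a l m"
  by (simp add: hankel_annihilators_def low_degree_def)

lemma det_hankel_nonzero_iff: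
  "det (hankel_mat l l \<alpha>) \<noteq> 0 \<longleftrightarrow> hankel_annihilators (vec_index \<alpha>) l l = {0}"
proof -
  let ?K = "hankel_annihilators (vec_index \<alpha>) l l"
  have z: "vec l (coeff p) = 0\<^sub>v l \<longleftrightarrow> p = 0" if "p \<in> ?K" for p
    using that by (auto simp: hankel_annihilators_def low_degree_def vec_eq_iff intro!: poly_eqI)
      (metis not_le)
  have "det (hankel_mat l l \<alpha>) \<noteq> 0 \<longleftrightarrow> (\<forall>v \<in> mat_kernel (hankel_mat l l \<alpha>). v = 0\<^sub>v l)"
    by (auto simp: det_0_iff_vec_prod_zero[OF hankel_mat_carrier] mat_kernel[OF hankel_mat_carrier])
  also have "\<dots> \<longleftrightarrow> (\<forall>p \<in> ?K. p = 0)"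
    unfolding bij_betw_imp_surj_on[OF hankel_kernel_bij[of l \<alpha> l], symmetric] using z by simp
  finally show ?thesis using zero_mem_hankel_annihilators by blast
qed

lemma transpose_hankel_mat: "(hankel_mat l m \<alpha>)\<^sup>T = hankel_mat m l \<alpha>"
  by (auto simp: hankel_mat_def add.commute)

text \<open>
  The annihilators are the kernel of the transposed Hankel matrix, which has the same rank.
\<close>

lemma card_hankel_annihilators:
  fixes \<alpha> :: "'a :: {field, finite} vec"
  shows "card (hankel_annihilators (vec_index \<alpha>) l m) * CARD('a) ^ mat_rank (hankel_mat l m \<alpha>)
    = CARD('a) ^ l"
  using bij_betw_same_card[OF hankel_kernel_bij[of l \<alpha> m]]
    card_kernel_times_card_range[OF hankel_mat_carrier[of m l \<alpha>]]
    rank_transpose[OF hankel_mat_carrier[of l m \<alpha>]]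
  by (simp add: transpose_hankel_mat)

section \<open>Monic orthogonal polynomials and discrepancies\<close>

definition monic_orthogonal :: "(nat \<Rightarrow> 'a :: field) \<Rightarrow> nat \<Rightarrow> 'a poly \<Rightarrow> bool" where
  "monic_orthogonal a \<rho> p \<longleftrightarrow>
     degree p = \<rho> \<and> lead_coeff p = 1 \<and> (\<forall>j<\<rho>. moment a (monom 1 j * p) = 0)"

lemma one_less_card_field: "1 < CARD('a :: {field, finite})"
  using card_mono[of "UNIV :: 'a set" "{0, 1}"] by simp

lemma moment_monom_mult_mult:
  assumes "v \<in> low_degree N"
  shows "moment a (monom 1 j * (v * p)) = (\<Sum>i<N. coeff v i * moment a (monom 1 (i + j) * p))"
proof -
  have swap: "monom 1 j * (v * p) = v * (monom 1 j * p)"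
    by (rule mult.left_commute)
  have shift: "monom 1 i * (monom 1 j * p) = monom 1 (i + j) * p" for i
    by (subst mult.assoc[symmetric]) (simp add: mult_monom)
  show ?thesis unfolding swap moment_mult[OF assms] shift ..
qed

lemma hankel_annihilators_mono:
  "p \<in> hankel_annihilators a l m \<Longrightarrow> p \<in> low_degree l' \<Longrightarrow> m' \<le> m \<Longrightarrow>
    p \<in> hankel_annihilators a l' m'"
  by (auto simp: hankel_annihilators_def)

text \<open>
  This is the central structural fact. The discrepancies vanish below index \<open>t\<close>, and \<open>t\<close> is the index of
  the first nonzero one unless all discrepancies that occur in the \<open>m \<times> l\<close> matrix vanish; these are the
  ones with index at most \<open>l + m - 2 - \<rho>\<close>. Divide an annihilator \<open>y = v * p + u\<close> by \<open>p\<close>. The first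
  \<open>\<rho>\<close> equations involve only vanishing discrepancies of \<open>p\<close>, so \<open>u\<close> is an annihilator for the
  nonsingular \<open>\<rho> \<times> \<rho>\<close> block and is zero. If \<open>v\<close> had degree \<open>e \<ge> t + 1 - m\<close>, then the equation
  number \<open>t - e\<close> would isolate the leading coefficient of \<open>v\<close> against the nonzero discrepancy \<open>t\<close>.
\<close>

lemma hankel_annihilators_eq:
  assumes nonsing: "hankel_annihilators a \<rho> \<rho> = {0}"
    and p: "monic_orthogonal a \<rho> p"
    and le: "\<rho> \<le> l" "l \<le> m" "l \<le> Suc t" "Suc (t + \<rho>) \<le> l + m"
    and zero: "\<And>i. i < t \<Longrightarrow> moment a (monom 1 i * p) = 0"
    and nonzero: "Suc (t + \<rho>) < l + m \<Longrightarrow> moment a (monom 1 t * p) \<noteq> 0"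
  shows "hankel_annihilators a l m = (\<lambda>v. v * p) ` low_degree (min (l - \<rho>) (Suc t - m))"
proof (intro equalityI subsetI)
  have deg: "degree p = \<rho>" and p0: "p \<noteq> 0" using p by (auto simp: monic_orthogonal_def)
  fix y assume y: "y \<in> hankel_annihilators a l m"
  define v where "v = y div p"
  define u where "u = y mod p"
  have split: "y = v * p + u" by (simp add: v_def u_def)
  have u: "u \<in> low_degree \<rho>"
    using degree_mod_less[OF p0, of y] by (auto simp: u_def low_degree_iff deg)
  have v: "v \<in> low_degree (l - \<rho>)"
  proof (cases "v = 0")
    case False
    then have vp: "degree (v * p) = degree v + \<rho>" "v * p \<noteq> 0"
      by (auto simp: degree_mult_eq p0 deg)
    have "degree y = degree v + \<rho>"
      using u degree_add_eq_left[of u "v * p"] vp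
      by (cases "u = 0") (auto simp: split low_degree_iff)
    moreover have "y \<noteq> 0" using calculation u vp by (auto simp: split low_degree_iff add_eq_0_iff)
    ultimately show ?thesis
      using y by (auto simp: hankel_annihilators_def low_degree_iff)
  qed (simp add: low_degree_iff)
  have y0: "moment a (monom 1 j * y) = 0" if "j < m" for j
    using y that by (simp add: hankel_annihilators_def)
  \<comment> \<open>the remainder solves the nonsingular system formed by the first \<open>\<rho>\<close> equations\<close>
  have "moment a (monom 1 j * u) = 0" if j: "j < \<rho>" for j
  proof -
    have "moment a (monom 1 j * (v * p)) = 0"
      unfolding moment_monom_mult_mult[OF v]
    proof (intro sum.neutral ballI)
      fix i assume "i \<in> {..<l - \<rho>}"
      then have "i + j < t" using j le by simp
      then show "coeff v i * moment a (monom 1 (i + j) * p) = 0" using zero by simp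
    qed
    moreover have "moment a (monom 1 j * y) = 0" using y0 j le by simp
    ultimately show ?thesis by (simp add: split distrib_left moment_add)
  qed
  then have "u \<in> hankel_annihilators a \<rho> \<rho>" using u by (simp add: hankel_annihilators_def)
  then have yvp: "y = v * p" using nonsing split by simp
  \<comment> \<open>equation \<open>t - e\<close> reads off the leading coefficient of the quotient\<close>
  have "v \<in> low_degree (Suc t - m)"
  proof (rule ccontr)
    assume n: "v \<notin> low_degree (Suc t - m)"
    define e where "e = degree v"
    have e: "v \<noteq> 0" "Suc t - m \<le> e" "e < l - \<rho>"
      using n v by (auto simp: e_def low_degree_iff)
    have nz: "moment a (monom 1 t * p) \<noteq> 0" using nonzero e le by linarith
    have et: "e \<le> t" "t - e < m" using e le by linarith+
    have "v \<in> low_degree (Suc e)" by (simp add: e_def low_degree_Suc_degree)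
    then have "moment a (monom 1 (t - e) * y)
        = (\<Sum>i<e. coeff v i * moment a (monom 1 (i + (t - e)) * p)) + coeff v e * moment a (monom 1 t * p)"
      using et by (simp add: yvp moment_monom_mult_mult)
    also have "\<dots> = coeff v e * moment a (monom 1 t * p)"
      using et by (simp add: zero)
    finally have "lead_coeff v = 0" using y0[OF et(2)] nz by (simp add: e_def)
    then show False using e by simp
  qed
  then show "y \<in> (\<lambda>v. v * p) ` low_degree (min (l - \<rho>) (Suc t - m))"
    using v yvp by (auto simp: low_degree_iff)
next
  have deg: "degree p = \<rho>" and p0: "p \<noteq> 0" using p by (auto simp: monic_orthogonal_def)
  fix y assume "y \<in> (\<lambda>v. v * p) ` low_degree (min (l - \<rho>) (Suc t - m))"
  then obtain v where v: "v \<in> low_degree (min (l - \<rho>) (Suc t - m))" and y: "y = v * p" by auto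
  have "y \<in> low_degree l"
    using v by (cases "v = 0") (auto simp: y low_degree_iff degree_mult_eq p0 deg)
  moreover have "moment a (monom 1 j * y) = 0" if "j < m" for j
    unfolding y moment_monom_mult_mult[OF v] using that by (intro sum.neutral) (auto intro!: zero)
  ultimately show "y \<in> hankel_annihilators a l m" by (simp add: hankel_annihilators_def)
qed

text \<open>
  If the discrepancy \<open>l - 1\<close> is nonzero, the degree bound for the cofactor is zero and there are no
  annihilators; if it vanishes, then \<open>p\<close> itself is an annihilator.
\<close>

lemma det_hankel_nonzero_iff_discrepancy:
  fixes \<alpha> :: "'a :: field vec"
  assumes det: "det (hankel_mat \<rho> \<rho> \<alpha>) \<noteq> 0"
    and p: "monic_orthogonal (vec_index \<alpha>) \<rho> p"
    and l: "\<rho> < l"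
    and zero: "\<And>i. i < l - 1 \<Longrightarrow> moment (vec_index \<alpha>) (monom 1 i * p) = 0"
  shows "det (hankel_mat l l \<alpha>) \<noteq> 0 \<longleftrightarrow> moment (vec_index \<alpha>) (monom 1 (l - 1) * p) \<noteq> 0"
proof
  assume "moment (vec_index \<alpha>) (monom 1 (l - 1) * p) \<noteq> 0"
  then have "hankel_annihilators (vec_index \<alpha>) l l = (\<lambda>v. v * p) ` low_degree (min (l - \<rho>) (Suc (l - 1) - l))"
    using det l by (intro hankel_annihilators_eq[OF _ p] zero) (auto simp: det_hankel_nonzero_iff)
  moreover have "low_degree 0 = {0 :: 'a poly}" by (auto simp: low_degree_iff)
  ultimately show "det (hankel_mat l l \<alpha>) \<noteq> 0"
    using l by (simp add: det_hankel_nonzero_iff)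
next
  have deg: "degree p = \<rho>" and p0: "p \<noteq> 0" using p by (auto simp: monic_orthogonal_def)
  assume d: "det (hankel_mat l l \<alpha>) \<noteq> 0"
  show "moment (vec_index \<alpha>) (monom 1 (l - 1) * p) \<noteq> 0"
  proof
    assume "moment (vec_index \<alpha>) (monom 1 (l - 1) * p) = 0"
    then have "moment (vec_index \<alpha>) (monom 1 j * p) = 0" if "j < l" for j
      using zero that by (cases "j = l - 1") auto
    then have "p \<in> hankel_annihilators (vec_index \<alpha>) l l"
      using l by (simp add: hankel_annihilators_def low_degree_iff deg)
    then show False using d p0 by (simp add: det_hankel_nonzero_iff)
  qed
qed

lemma dets_zero_iff_discrepancies_zero:
  fixes \<alpha> :: "'a :: field vec"
  assumes det: "det (hankel_mat \<rho> \<rho> \<alpha>) \<noteq> 0"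
    and p: "monic_orthogonal (vec_index \<alpha>) \<rho> p"
  shows "(\<forall>l\<in>{\<rho><..N}. det (hankel_mat l l \<alpha>) = 0) \<longleftrightarrow>
    (\<forall>i<N. moment (vec_index \<alpha>) (monom 1 i * p) = 0)"
proof (induction N)
  case (Suc N)
  show ?case
  proof (cases "\<rho> \<le> N")
    case True
    then have "{\<rho><..Suc N} = insert (Suc N) {\<rho><..N}" by auto
    then have "(\<forall>l\<in>{\<rho><..Suc N}. det (hankel_mat l l \<alpha>) = 0) \<longleftrightarrow>
        det (hankel_mat (Suc N) (Suc N) \<alpha>) = 0 \<and> (\<forall>i<N. moment (vec_index \<alpha>) (monom 1 i * p) = 0)"
      using Suc by simp
    also have "\<dots> \<longleftrightarrow> moment (vec_index \<alpha>) (monom 1 N * p) = 0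
        \<and> (\<forall>i<N. moment (vec_index \<alpha>) (monom 1 i * p) = 0)"
      using det_hankel_nonzero_iff_discrepancy[OF det p, of "Suc N"] True by auto
    also have "\<dots> \<longleftrightarrow> (\<forall>i<Suc N. moment (vec_index \<alpha>) (monom 1 i * p) = 0)"
      by (auto simp: less_Suc_eq)
    finally show ?thesis .
  next
    case False
    then show ?thesis using p by (auto simp: monic_orthogonal_def)
  qed
qed simp

text \<open>
  There are \<open>\<rho>\<close> equations for \<open>\<rho> + 1\<close> coefficients, so a nonzero annihilator of degree at most \<open>\<rho>\<close>
  exists. Its degree is \<open>\<rho>\<close>, as the square system for degree less than \<open>\<rho>\<close> has only the trivial
  solution.
\<close>

lemma monic_orthogonal_exists:
  fixes \<alpha> :: "'a :: {field, finite} vec"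
  assumes "det (hankel_mat \<rho> \<rho> \<alpha>) \<noteq> 0"
  shows "\<exists>p. monic_orthogonal (vec_index \<alpha>) \<rho> p"
proof -
  let ?K = "hankel_annihilators (vec_index \<alpha>) (Suc \<rho>) \<rho>"
  have "CARD('a) ^ Suc \<rho> = card ?K * CARD('a) ^ mat_rank (hankel_mat (Suc \<rho>) \<rho> \<alpha>)"
    using card_hankel_annihilators by metis
  also have "\<dots> \<le> card ?K * CARD('a) ^ \<rho>"
    using vec_space.rank_le_nc[OF hankel_mat_carrier, of "Suc \<rho>" \<rho> \<alpha>]
    by (intro mult_le_mono2 power_increasing) auto
  finally have "CARD('a) \<le> card ?K" by simp
  then have "?K \<noteq> {0}" using one_less_card_field[where 'a = 'a] by auto
  moreover have "\<exists>y\<in>K. y \<noteq> 0" if "K \<noteq> {0}" "0 \<in> K" for K :: "'a poly set"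
    using that by auto
  ultimately obtain y where y: "y \<in> ?K" "y \<noteq> 0" using zero_mem_hankel_annihilators by metis
  have "y \<notin> low_degree \<rho>"
  proof
    assume "y \<in> low_degree \<rho>"
    then have "y \<in> hankel_annihilators (vec_index \<alpha>) \<rho> \<rho>"
      using y by (auto intro: hankel_annihilators_mono)
    then show False using assms y by (simp add: det_hankel_nonzero_iff)
  qed
  then have deg: "degree y = \<rho>"
    using y by (auto simp: low_degree_iff hankel_annihilators_def)
  define p where "p = smult (inverse (lead_coeff y)) y"
  have "moment (vec_index \<alpha>) (monom 1 j * p) = 0" if "j < \<rho>" for j
    using y that by (simp add: p_def moment_smult hankel_annihilators_def)
  then show ?thesis using deg y by (intro exI[of _ p]) (auto simp: monic_orthogonal_def p_def)
qed

text \<open>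
  The empty determinant is 1, so the default value 0 of the invariant is covered by the same
  description as the maximum.
\<close>

lemma hankel_rho_eq_iff:
  fixes \<alpha> :: "'a :: field vec"
  shows "hankel_rho n \<alpha> = \<rho> \<longleftrightarrow>
    \<rho> \<le> n1 n \<and> det (hankel_mat \<rho> \<rho> \<alpha>) \<noteq> 0 \<and> (\<forall>l\<in>{\<rho><..n1 n}. det (hankel_mat l l \<alpha>) = 0)"
proof -
  define S where "S = {l \<in> {1..n1 n}. det (hankel_mat l l \<alpha>) \<noteq> 0}"
  have fin: "finite S" by (simp add: S_def)
  have det0: "det (hankel_mat 0 0 \<alpha>) = 1"
    by (rule det_dim_zero) simp
  have ex: "(\<exists>l\<in>{1..n1 n}. det (hankel_mat l l \<alpha>) \<noteq> 0) \<longleftrightarrow> S \<noteq> {}"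
    unfolding S_def by blast
  have rho: "hankel_rho n \<alpha> = (if S = {} then 0 else Max S)"
    unfolding hankel_rho_def ex S_def[symmetric] by simp
  have mem: "\<rho> \<in> S \<longleftrightarrow> \<rho> \<noteq> 0 \<and> \<rho> \<le> n1 n \<and> det (hankel_mat \<rho> \<rho> \<alpha>) \<noteq> 0" for \<rho>
    by (auto simp: S_def)
  show ?thesis
  proof (cases "S = {}")
    case True
    then have "det (hankel_mat l l \<alpha>) = 0" if "0 < l" "l \<le> n1 n" for l
      using mem[of l] that by simp
    then show ?thesis
      using det0 True by (cases "\<rho> = 0") (auto simp: rho)
  next
    case False
    then have "hankel_rho n \<alpha> = \<rho> \<longleftrightarrow> \<rho> \<in> S \<and> (\<forall>l \<in> S. l \<le> \<rho>)"
      using Max_eq_iff[OF fin False] by (auto simp: rho)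
    also have "\<dots> \<longleftrightarrow> \<rho> \<le> n1 n \<and> det (hankel_mat \<rho> \<rho> \<alpha>) \<noteq> 0 \<and>
        (\<forall>l\<in>{\<rho><..n1 n}. det (hankel_mat l l \<alpha>) = 0)"
    proof -
      have "(\<forall>l \<in> S. l \<le> \<rho>) \<longleftrightarrow> (\<forall>l\<in>{\<rho><..n1 n}. det (hankel_mat l l \<alpha>) = 0)"
        unfolding S_def by (auto simp flip: not_less) (metis gr_zeroI less_zeroE)
      moreover have "\<not> (\<forall>l \<in> S. l \<le> \<rho>)" if "\<rho> = 0"
        using False that by (auto simp: S_def)
      ultimately show ?thesis unfolding mem by blast
    qed
    finally show ?thesis .
  qed
qed

lemma rank_hankel_mat_eq:
  fixes \<alpha> :: "'a :: {field, finite} vec"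
  assumes det: "det (hankel_mat \<rho> \<rho> \<alpha>) \<noteq> 0"
    and p: "monic_orthogonal (vec_index \<alpha>) \<rho> p"
    and le: "\<rho> \<le> l" "l \<le> m" "l \<le> Suc t" "Suc (t + \<rho>) \<le> l + m"
    and zero: "\<And>i. i < t \<Longrightarrow> moment (vec_index \<alpha>) (monom 1 i * p) = 0"
    and nonzero: "Suc (t + \<rho>) < l + m \<Longrightarrow> moment (vec_index \<alpha>) (monom 1 t * p) \<noteq> 0"
  shows "mat_rank (hankel_mat l m \<alpha>) = min l (l + m - Suc t)"
proof -
  let ?k = "min (l - \<rho>) (Suc t - m)" and ?r = "mat_rank (hankel_mat l m \<alpha>)"
  have "p \<noteq> 0" using p by (auto simp: monic_orthogonal_def)
  then have "inj_on (\<lambda>v. v * p) (low_degree ?k)" by (auto simp: inj_on_def)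
  then have "card (hankel_annihilators (vec_index \<alpha>) l m) = CARD('a) ^ ?k"
    using hankel_annihilators_eq[OF _ p le zero nonzero] det
    by (simp add: det_hankel_nonzero_iff card_image card_low_degree)
  then have "CARD('a) ^ (?k + ?r) = CARD('a) ^ l"
    using card_hankel_annihilators[of \<alpha> l m] by (simp add: power_add)
  then have "?k + ?r = l" using one_less_card_field[where 'a = 'a] by (metis power_inject_exp)
  then show ?thesis using le by linarith
qed

section \<open>The two invariants in terms of the discrepancies\<close>

lemma hankel_annihilators_trivial_mono:
  assumes "hankel_annihilators a \<rho> \<rho> = {0}" "l \<le> \<rho>" "\<rho> \<le> m"
  shows "hankel_annihilators a l m = {0}"
proof -
  have "p \<in> hankel_annihilators a \<rho> \<rho>" if "p \<in> hankel_annihilators a l m" for p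
    using that assms(2,3) by (auto simp: hankel_annihilators_def intro: low_degree_mono)
  then show ?thesis using assms(1) zero_mem_hankel_annihilators[of a l m] by auto
qed

lemma hankel_rho_eq_iff_discrepancies:
  fixes \<alpha> :: "'a :: field vec"
  assumes "\<rho> \<le> n1 n" "det (hankel_mat \<rho> \<rho> \<alpha>) \<noteq> 0" "monic_orthogonal (vec_index \<alpha>) \<rho> p"
  shows "hankel_rho n \<alpha> = \<rho> \<longleftrightarrow> (\<forall>i<n1 n. moment (vec_index \<alpha>) (monom 1 i * p) = 0)"
  using assms dets_zero_iff_discrepancies_zero[OF assms(2,3)] by (simp add: hankel_rho_eq_iff)

text \<open>
  The discrepancies that are determined by a tuple of length \<open>n + 1\<close> are those with index at most
  \<open>n - \<rho>\<close>; if all of them vanish, \<open>t\<close> is \<open>n + 1 - \<rho>\<close>. When \<open>l < \<rho>\<close> the structure of the annihilators is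
  not available, but then the first \<open>\<rho>\<close> equations already force them to be trivial and the rank
  is \<open>l\<close>.
\<close>

lemma rank_hankel_mat_first_discrepancy:
  fixes \<alpha> :: "'a :: {field, finite} vec"
  assumes rho: "hankel_rho n \<alpha> = \<rho>"
    and p: "monic_orthogonal (vec_index \<alpha>) \<rho> p"
    and t: "t \<le> n + 1 - \<rho>"
    and zero: "\<And>i. i < t \<Longrightarrow> moment (vec_index \<alpha>) (monom 1 i * p) = 0"
    and nonzero: "t < n + 1 - \<rho> \<Longrightarrow> moment (vec_index \<alpha>) (monom 1 t * p) \<noteq> 0"
    and lm: "l \<le> m" "l + m = n + 2"
  shows "mat_rank (hankel_mat l m \<alpha>) = min l (n + 1 - t)"
proof -
  have rho_le: "\<rho> \<le> n1 n" and det: "det (hankel_mat \<rho> \<rho> \<alpha>) \<noteq> 0"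
    using rho by (auto simp: hankel_rho_eq_iff)
  have "l \<le> Suc t"
  proof (cases "t < n1 n")
    case True
    then have "t = n + 1 - \<rho>"
      using nonzero t hankel_rho_eq_iff_discrepancies[OF rho_le det p] rho by fastforce
    then show ?thesis using lm rho_le by (auto simp: n1_def)
  next
    case False
    then show ?thesis using lm by (auto simp: n1_def)
  qed
  show ?thesis
  proof (cases "\<rho> \<le> l")
    case True
    have "mat_rank (hankel_mat l m \<alpha>) = min l (l + m - Suc t)"
      using True lm \<open>l \<le> Suc t\<close> t zero nonzero
      by (intro rank_hankel_mat_eq[OF det p]) auto
    then show ?thesis using lm by simp
  next
    case False
    have "hankel_annihilators (vec_index \<alpha>) l m = {0}"
    proof (rule hankel_annihilators_trivial_mono)
      show "hankel_annihilators (vec_index \<alpha>) \<rho> \<rho> = {0}"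
        using det by (simp only: det_hankel_nonzero_iff)
      show "l \<le> \<rho>" "\<rho> \<le> m" using False lm rho_le by (auto simp: n1_def)
    qed
    then have "CARD('a) ^ mat_rank (hankel_mat l m \<alpha>) = CARD('a) ^ l"
      using card_hankel_annihilators[of \<alpha> l m] by simp
    then have "mat_rank (hankel_mat l m \<alpha>) = l"
      using one_less_card_field[where 'a = 'a] by (metis power_inject_exp)
    then show ?thesis using False t rho_le by (simp add: n1_def)
  qed
qed

lemma first_nonzero_below:
  fixes f :: "nat \<Rightarrow> 'b :: zero"
  obtains t where "t \<le> N" "\<And>i. i < t \<Longrightarrow> f i = 0" "t < N \<Longrightarrow> f t \<noteq> 0"
proof -
  define t where "t = (LEAST i. N \<le> i \<or> f i \<noteq> 0)"
  have "N \<le> t \<or> f t \<noteq> 0" unfolding t_def by (rule LeastI[of _ N]) simp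
  moreover have "t \<le> N" unfolding t_def by (rule Least_le) simp
  moreover have "f i = 0" if "i < t" for i using that not_less_Least unfolding t_def by blast
  ultimately show ?thesis using that[of t] by auto
qed

lemma monic_orthogonal_hankel_rho_exists:
  fixes \<alpha> :: "'a :: {field, finite} vec"
  shows "\<exists>p. monic_orthogonal (vec_index \<alpha>) (hankel_rho n \<alpha>) p"
proof (rule monic_orthogonal_exists)
  show "det (hankel_mat (hankel_rho n \<alpha>) (hankel_rho n \<alpha>) \<alpha>) \<noteq> 0"
    using hankel_rho_eq_iff[THEN iffD1, OF refl] by blast
qed

lemma n1_add_n2: "n1 n + n2 n = n + 2" and n1_le_n2: "n1 n \<le> n2 n"
  by (auto simp: n1_def n2_def)

text \<open>
  All shapes with \<open>l + m = n + 2\<close> see the same first nonzero discrepancy, and their rank is the same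
  number cut off by the smaller side, which is largest for the almost square shape.
\<close>

lemma rank_hankel_mat_min:
  fixes \<alpha> :: "'a :: {field, finite} vec"
  assumes "l + m = n + 2"
  shows "mat_rank (hankel_mat l m \<alpha>) = min (min l m) (mat_rank (hankel_mat (n1 n) (n2 n) \<alpha>))"
proof -
  obtain p where p: "monic_orthogonal (vec_index \<alpha>) (hankel_rho n \<alpha>) p"
    using monic_orthogonal_hankel_rho_exists by blast
  obtain t where t: "t \<le> n + 1 - hankel_rho n \<alpha>"
    "\<And>i. i < t \<Longrightarrow> moment (vec_index \<alpha>) (monom 1 i * p) = 0"
    "t < n + 1 - hankel_rho n \<alpha> \<Longrightarrow> moment (vec_index \<alpha>) (monom 1 t * p) \<noteq> 0"
    using first_nonzero_below[where f = "\<lambda>i. moment (vec_index \<alpha>) (monom 1 i * p)"] by metis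
  note rank = rank_hankel_mat_first_discrepancy[OF refl p t]
  have main: "mat_rank (hankel_mat l m \<alpha>) = min l (mat_rank (hankel_mat (n1 n) (n2 n) \<alpha>))"
    if "l \<le> m" "l + m = n + 2" for l m
  proof -
    have "mat_rank (hankel_mat l m \<alpha>) = min l (n + 1 - t)"
      using rank that by blast
    moreover have "mat_rank (hankel_mat (n1 n) (n2 n) \<alpha>) = min (n1 n) (n + 1 - t)"
      using rank n1_le_n2 n1_add_n2 by blast
    moreover have "l \<le> n1 n" using that by (simp add: n1_def)
    ultimately show ?thesis by linarith
  qed
  have "mat_rank (hankel_mat l m \<alpha>) = mat_rank (hankel_mat m l \<alpha>)"
    using rank_transpose[OF hankel_mat_carrier[of l m \<alpha>]] by (simp add: transpose_hankel_mat)
  then show ?thesis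
    using main[of l m] main[of m l] assms by (cases "l \<le> m") (simp_all add: min_absorb1 min_absorb2)
qed

lemma rank_hankel_mat_le_n1:
  fixes \<alpha> :: "'a :: {field, finite} vec"
  shows "mat_rank (hankel_mat (n1 n) (n2 n) \<alpha>) \<le> n1 n"
  using rank_hankel_mat_min[OF n1_add_n2, of n \<alpha>] by linarith

text \<open>
  For \<open>\<rho> < n_1\<close> all discrepancies below \<open>n_1\<close> vanish, so \<open>n + 1 - t \<le> n_1\<close> and the rank is exactly
  \<open>n + 1 - t\<close>.
\<close>

lemma rank_hankel_mat_le_iff:
  fixes \<alpha> :: "'a :: {field, finite} vec"
  assumes rho: "hankel_rho n \<alpha> = \<rho>" "\<rho> < n1 n"
    and p: "monic_orthogonal (vec_index \<alpha>) \<rho> p"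
    and r: "\<rho> \<le> r" "r \<le> n + 1 - n1 n"
  shows "mat_rank (hankel_mat (n1 n) (n2 n) \<alpha>) \<le> r \<longleftrightarrow>
    (\<forall>i<n + 1 - r. moment (vec_index \<alpha>) (monom 1 i * p) = 0)"
proof -
  obtain t where le: "t \<le> n + 1 - \<rho>"
    and zero: "\<And>i. i < t \<Longrightarrow> moment (vec_index \<alpha>) (monom 1 i * p) = 0"
    and nonzero: "t < n + 1 - \<rho> \<Longrightarrow> moment (vec_index \<alpha>) (monom 1 t * p) \<noteq> 0"
    using first_nonzero_below[where f = "\<lambda>i. moment (vec_index \<alpha>) (monom 1 i * p)"] by metis
  have det: "\<rho> \<le> n1 n" "det (hankel_mat \<rho> \<rho> \<alpha>) \<noteq> 0" using rho by (auto simp: hankel_rho_eq_iff)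
  have rank: "mat_rank (hankel_mat (n1 n) (n2 n) \<alpha>) = min (n1 n) (n + 1 - t)"
    by (rule rank_hankel_mat_first_discrepancy[OF rho(1) p le zero nonzero n1_le_n2 n1_add_n2])
  have "n1 n \<le> t"
  proof (rule ccontr)
    assume "\<not> n1 n \<le> t"
    then have "moment (vec_index \<alpha>) (monom 1 t * p) = 0" "t < n + 1 - \<rho>"
      using hankel_rho_eq_iff_discrepancies[OF det p] rho by (auto simp: n1_def)
    then show False using nonzero by simp
  qed
  then have "mat_rank (hankel_mat (n1 n) (n2 n) \<alpha>) = n + 1 - t"
    using rank by (simp add: n1_def)
  also have "\<dots> \<le> r \<longleftrightarrow> n + 1 - r \<le> t" by linarith
  also have "\<dots> \<longleftrightarrow> (\<forall>i<n + 1 - r. moment (vec_index \<alpha>) (monom 1 i * p) = 0)"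
  proof
    assume *: "\<forall>i<n + 1 - r. moment (vec_index \<alpha>) (monom 1 i * p) = 0"
    show "n + 1 - r \<le> t"
    proof (rule ccontr)
      assume n: "\<not> n + 1 - r \<le> t"
      then have "moment (vec_index \<alpha>) (monom 1 t * p) = 0" using * by simp
      then show False using nonzero n r by simp
    qed
  qed (use zero in auto)
  finally show ?thesis .
qed

lemma rank_le_of_hankel_rho_less:
  fixes \<alpha> :: "'a :: {field, finite} vec"
  assumes "hankel_rho n \<alpha> < n1 n"
  shows "mat_rank (hankel_mat (n1 n) (n2 n) \<alpha>) \<le> n + 1 - n1 n"
proof -
  define \<rho> where "\<rho> = hankel_rho n \<alpha>"
  have det: "\<rho> \<le> n1 n" "det (hankel_mat \<rho> \<rho> \<alpha>) \<noteq> 0"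
    using hankel_rho_eq_iff[of n \<alpha> \<rho>] by (auto simp: \<rho>_def)
  obtain p where p: "monic_orthogonal (vec_index \<alpha>) \<rho> p"
    using monic_orthogonal_exists[OF det(2)] by blast
  have "\<forall>i<n1 n. moment (vec_index \<alpha>) (monom 1 i * p) = 0"
    using hankel_rho_eq_iff_discrepancies[OF det p] by (simp add: \<rho>_def)
  moreover have "n + 1 - (n + 1 - n1 n) = n1 n" by (simp add: n1_def)
  ultimately show ?thesis
    using rank_hankel_mat_le_iff[OF \<rho>_def[symmetric] _ p, of "n + 1 - n1 n"] assms
    by (auto simp: \<rho>_def n1_def)
qed

section \<open>Counting tuples with given invariant and bounded rank\<close>

lemma card_vecs_prefix:
  fixes P :: "'a :: {zero, finite} vec \<Rightarrow> bool"
  assumes le: "K \<le> s" "s \<le> N"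
    and prefix: "\<And>\<beta> \<gamma>. (\<And>i. i < K \<Longrightarrow> \<beta> $ i = \<gamma> $ i) \<Longrightarrow> P \<beta> = P \<gamma>"
  shows "card {\<gamma> \<in> carrier_vec N. P \<gamma> \<and> (\<forall>i. K \<le> i \<longrightarrow> i < s \<longrightarrow> \<gamma> $ i = 0)} =
    card {\<beta> \<in> carrier_vec K. P \<beta>} * CARD('a) ^ (N - s)" (is "card ?L = _")
proof -
  let ?glue = "\<lambda>(\<beta>, w). vec N (\<lambda>i. if i < K then \<beta> $ i else if i < s then 0 else w $ (i - s))"
  let ?split = "\<lambda>\<gamma>. (vec K (vec_index \<gamma>), vec (N - s) (\<lambda>i. \<gamma> $ (i + s)))"
  have "bij_betw ?glue ({\<beta> \<in> carrier_vec K. P \<beta>} \<times> carrier_vec (N - s)) ?L"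
  proof (rule bij_betw_byWitness[where f' = ?split])
    show "?glue ` ({\<beta> \<in> carrier_vec K. P \<beta>} \<times> carrier_vec (N - s)) \<subseteq> ?L"
    proof (clarsimp, intro conjI)
      fix \<beta> w :: "'a vec" assume "P \<beta>"
      moreover have "P (vec N (\<lambda>i. if i < K then \<beta> $ i else if i < s then 0 else w $ (i - s))) = P \<beta>"
        by (rule prefix) (use le in simp)
      ultimately show "P (vec N (\<lambda>i. if i < K then \<beta> $ i else if i < s then 0 else w $ (i - s)))"
        by simp
    qed (use le in auto)
    show "?split ` ?L \<subseteq> {\<beta> \<in> carrier_vec K. P \<beta>} \<times> carrier_vec (N - s)"
    proof clarsimp
      fix \<gamma> :: "'a vec" assume "P \<gamma>"
      moreover have "P (vec K (vec_index \<gamma>)) = P \<gamma>" by (rule prefix) simp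
      ultimately show "P (vec K (vec_index \<gamma>))" by simp
    qed
  qed (use le in \<open>auto simp: vec_eq_iff\<close>)
  from bij_betw_same_card[OF this]
  have "card ?L = card ({\<beta> \<in> carrier_vec K. P \<beta>} \<times> (carrier_vec (N - s) :: 'a vec set))"
    by (rule sym)
  then show ?thesis by (simp add: card_cartesian_product card_carrier_vec)
qed

lemma card_vecs_zero_prefix:
  assumes "s \<le> N"
  shows "card {\<gamma> \<in> carrier_vec N. \<forall>i<s. \<gamma> $ i = (0 :: 'a :: {zero, finite})} = CARD('a) ^ (N - s)"
proof -
  have "card {\<gamma> \<in> carrier_vec N. True \<and> (\<forall>i. 0 \<le> i \<longrightarrow> i < s \<longrightarrow> \<gamma> $ i = (0 :: 'a))} =
      card {\<beta> \<in> carrier_vec 0 :: 'a vec set. True} * CARD('a) ^ (N - s)"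
    by (rule card_vecs_prefix) (use assms in auto)
  then show ?thesis by (simp add: card_carrier_vec)
qed

definition hankel_nonsing :: "nat \<Rightarrow> nat \<Rightarrow> nat \<Rightarrow> 'a :: field vec set" where
  "hankel_nonsing N h \<rho> = {\<alpha> \<in> carrier_vec N. (\<forall>i<h. \<alpha> $ i = 0) \<and> det (hankel_mat \<rho> \<rho> \<alpha>) \<noteq> 0}"

lemma hankel_mat_cong:
  assumes "\<And>i. i + 1 < l + m \<Longrightarrow> \<alpha> $ i = \<beta> $ i"
  shows "hankel_mat l m \<alpha> = hankel_mat l m \<beta>"
  using assms by (auto simp: hankel_mat_def)

text \<open>
  The first column of the matrix is zero; equivalently, the constant polynomial 1 is an annihilator. This
  is why a positive invariant has to exceed the number of leading zeros.
\<close>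

lemma det_hankel_zero_prefix:
  fixes \<alpha> :: "'a :: field vec"
  assumes "0 < \<rho>" "\<rho> \<le> h" "\<And>i. i < h \<Longrightarrow> \<alpha> $ i = 0"
  shows "det (hankel_mat \<rho> \<rho> \<alpha>) = 0"
proof -
  have "1 \<in> hankel_annihilators (vec_index \<alpha>) \<rho> \<rho>"
    using assms by (auto simp: hankel_annihilators_def low_degree_iff moment_monom)
  then have "hankel_annihilators (vec_index \<alpha>) \<rho> \<rho> \<noteq> {0}" by force
  then show ?thesis using det_hankel_nonzero_iff by blast
qed

lemma card_hankel_nonsing_prefix:
  assumes "h \<le> K" "2 * \<rho> \<le> K + 1" "K \<le> s" "s \<le> N"
  shows "card {\<alpha> \<in> hankel_nonsing N h \<rho> :: 'a :: {field, finite} vec set. \<forall>i. K \<le> i \<longrightarrow> i < s \<longrightarrow> \<alpha> $ i = 0} =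
    card (hankel_nonsing K h \<rho> :: 'a vec set) * CARD('a) ^ (N - s)"
proof -
  let ?P = "\<lambda>\<alpha> :: 'a vec. (\<forall>i<h. \<alpha> $ i = 0) \<and> det (hankel_mat \<rho> \<rho> \<alpha>) \<noteq> 0"
  have "?P \<beta> = ?P \<gamma>" if "\<And>i. i < K \<Longrightarrow> \<beta> $ i = \<gamma> $ i" for \<beta> \<gamma> :: "'a vec"
  proof -
    have "hankel_mat \<rho> \<rho> \<beta> = hankel_mat \<rho> \<rho> \<gamma>"
      using that assms by (intro hankel_mat_cong) auto
    moreover have "(\<forall>i<h. \<beta> $ i = 0) \<longleftrightarrow> (\<forall>i<h. \<gamma> $ i = 0)"
      using that assms by auto
    ultimately show ?thesis by simp
  qed
  then have "card {\<gamma> \<in> carrier_vec N. ?P \<gamma> \<and> (\<forall>i. K \<le> i \<longrightarrow> i < s \<longrightarrow> \<gamma> $ i = 0)} =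
    card {\<beta> \<in> carrier_vec K. ?P \<beta>} * CARD('a) ^ (N - s)"
    by (rule card_vecs_prefix[OF assms(3,4)])
  then show ?thesis by (simp add: hankel_nonsing_def conj_assoc)
qed

definition orthogonal_poly :: "'a :: field vec \<Rightarrow> nat \<Rightarrow> 'a poly" where
  "orthogonal_poly \<alpha> \<rho> = (SOME p. monic_orthogonal (vec_index \<alpha>) \<rho> p)"

text \<open>
  New coordinates for a tuple: the entry at position \<open>i \<ge> 2 * \<rho>\<close> is replaced by the discrepancy
  \<open>i - \<rho>\<close>, the one in which that entry appears with coefficient 1 and no later entry appears.
\<close>

definition discrepancies :: "nat \<Rightarrow> nat \<Rightarrow> 'a :: field vec \<Rightarrow> 'a vec" where
  "discrepancies N \<rho> \<alpha> = vec N (\<lambda>i. if i < 2 * \<rho> then \<alpha> $ i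
     else moment (vec_index \<alpha>) (monom 1 (i - \<rho>) * orthogonal_poly \<alpha> \<rho>))"

lemma monic_orthogonal_orthogonal_poly:
  fixes \<alpha> :: "'a :: {field, finite} vec"
  assumes "det (hankel_mat \<rho> \<rho> \<alpha>) \<noteq> 0"
  shows "monic_orthogonal (vec_index \<alpha>) \<rho> (orthogonal_poly \<alpha> \<rho>)"
  unfolding orthogonal_poly_def using monic_orthogonal_exists[OF assms] by (rule someI_ex)

text \<open>
  The orthogonality conditions involve only the entries below \<open>2 * \<rho>\<close>. The two predicates therefore
  agree for every polynomial, and the choice operator picks the same polynomial.
\<close>

lemma orthogonal_poly_cong:
  assumes "\<And>i. i < 2 * \<rho> \<Longrightarrow> \<alpha> $ i = \<beta> $ i"
  shows "orthogonal_poly \<alpha> \<rho> = orthogonal_poly \<beta> \<rho>"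
proof -
  have "monic_orthogonal (vec_index \<alpha>) \<rho> p \<longleftrightarrow> monic_orthogonal (vec_index \<beta>) \<rho> p" for p
  proof (cases "degree p = \<rho>")
    case True
    then have "p \<in> low_degree (Suc \<rho>)" by (simp add: low_degree_iff)
    then have "moment (vec_index \<alpha>) (monom 1 j * p) = moment (vec_index \<beta>) (monom 1 j * p)"
      if "j < \<rho>" for j
      using that assms by (simp add: moment_monom_mult)
    then show ?thesis by (auto simp: monic_orthogonal_def)
  qed (simp add: monic_orthogonal_def)
  then show ?thesis by (simp add: orthogonal_poly_def)
qed

lemma moment_shift_monic:
  assumes "monic_orthogonal a \<rho> p"
  shows "moment a (monom 1 j * p) = (\<Sum>i<\<rho>. coeff p i * a (j + i)) + a (j + \<rho>)"
proof -
  have "p \<in> low_degree (Suc \<rho>)" using assms by (simp add: low_degree_iff monic_orthogonal_def)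
  then show ?thesis using assms by (auto simp: moment_monom_mult monic_orthogonal_def)
qed

text \<open>
  The prefix of length \<open>2 * \<rho>\<close> fixes the orthogonal polynomial, and then each later entry is recovered
  from its discrepancy and the entries before it.
\<close>

lemma inj_on_discrepancies:
  "inj_on (discrepancies N \<rho>) (hankel_nonsing N h \<rho> :: 'a :: {field, finite} vec set)"
proof
  fix \<alpha> \<beta> :: "'a vec"
  assume \<alpha>: "\<alpha> \<in> hankel_nonsing N h \<rho>" and \<beta>: "\<beta> \<in> hankel_nonsing N h \<rho>"
    and eq: "discrepancies N \<rho> \<alpha> = discrepancies N \<rho> \<beta>"
  have comp: "discrepancies N \<rho> \<alpha> $ i = discrepancies N \<rho> \<beta> $ i" for i using eq by simp
  have same: "\<alpha> $ i = \<beta> $ i" if "i < N" for i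
    using that
  proof (induction i rule: less_induct)
    case (less i)
    show ?case
    proof (cases "i < 2 * \<rho>")
      case True
      then show ?thesis using comp[of i] less.prems by (simp add: discrepancies_def)
    next
      case False
      have "orthogonal_poly \<alpha> \<rho> = orthogonal_poly \<beta> \<rho>"
        using False less by (intro orthogonal_poly_cong) auto
      moreover have "monic_orthogonal (vec_index \<alpha>) \<rho> (orthogonal_poly \<alpha> \<rho>)"
        "monic_orthogonal (vec_index \<beta>) \<rho> (orthogonal_poly \<beta> \<rho>)"
        using \<alpha> \<beta> by (auto simp: hankel_nonsing_def intro: monic_orthogonal_orthogonal_poly)
      moreover have "(\<Sum>k<\<rho>. coeff p k * \<alpha> $ (i - \<rho> + k)) = (\<Sum>k<\<rho>. coeff p k * \<beta> $ (i - \<rho> + k))" for p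
        using False less by (intro sum.cong) auto
      ultimately show ?thesis
        using comp[of i] less.prems False by (simp add: discrepancies_def moment_shift_monic)
    qed
  qed
  show "\<alpha> = \<beta>" using \<alpha> \<beta> same by (intro eq_vecI) (auto simp: hankel_nonsing_def)
qed

text \<open>
  The leading zeros survive: for \<open>\<rho> > 0\<close> they lie in the unchanged prefix, because \<open>h < \<rho>\<close>, and for
  \<open>\<rho> = 0\<close> the orthogonal polynomial is 1 and nothing changes.
\<close>

lemma discrepancies_mem:
  fixes \<alpha> :: "'a :: {field, finite} vec"
  assumes \<alpha>: "\<alpha> \<in> hankel_nonsing N h \<rho>" and N: "2 * \<rho> \<le> N" "h \<le> N"
  shows "discrepancies N \<rho> \<alpha> \<in> hankel_nonsing N h \<rho>"
proof -
  have same: "discrepancies N \<rho> \<alpha> $ i = \<alpha> $ i" if "i < 2 * \<rho>" for i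
    using that N by (simp add: discrepancies_def)
  have "hankel_mat \<rho> \<rho> (discrepancies N \<rho> \<alpha>) = hankel_mat \<rho> \<rho> \<alpha>"
    using same by (intro hankel_mat_cong) auto
  moreover have "discrepancies N \<rho> \<alpha> $ i = 0" if "i < h" for i
  proof (cases "\<rho> = 0")
    case True
    have "monic_orthogonal (vec_index \<alpha>) \<rho> (orthogonal_poly \<alpha> \<rho>)"
      using \<alpha> by (auto simp: hankel_nonsing_def intro: monic_orthogonal_orthogonal_poly)
    then show ?thesis
      using \<alpha> that True N by (simp add: discrepancies_def moment_shift_monic hankel_nonsing_def)
  next
    case False
    then have "h < \<rho>"
      using \<alpha> det_hankel_zero_prefix[of \<rho> h \<alpha>] 
      by (cases "h < \<rho>") (auto simp: hankel_nonsing_def)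
    then show ?thesis using \<alpha> same that by (simp add: hankel_nonsing_def)
  qed
  ultimately show ?thesis using \<alpha> by (simp add: hankel_nonsing_def discrepancies_def)
qed

lemma bij_betw_discrepancies:
  assumes "2 * \<rho> \<le> N" "h \<le> N"
  shows "bij_betw (discrepancies N \<rho>) (hankel_nonsing N h \<rho>)
    (hankel_nonsing N h \<rho> :: 'a :: {field, finite} vec set)"
proof -
  have "finite (hankel_nonsing N h \<rho> :: 'a vec set)"
    by (rule finite_subset[OF _ finite_carrier_vec[of N]]) (auto simp: hankel_nonsing_def)
  then have "discrepancies N \<rho> ` hankel_nonsing N h \<rho> = (hankel_nonsing N h \<rho> :: 'a vec set)"
    using discrepancies_mem[OF _ assms] inj_on_discrepancies by (intro endo_inj_surj) auto
  then show ?thesis using inj_on_discrepancies by (simp add: bij_betw_def)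
qed

definition hankel_tuples_rho_le :: "nat \<Rightarrow> nat \<Rightarrow> nat \<Rightarrow> nat \<Rightarrow> 'a :: field vec set" where
  "hankel_tuples_rho_le n h \<rho> r = {\<alpha> \<in> carrier_vec (n + 1). (\<forall>i<h. \<alpha> $ i = 0) \<and>
     hankel_rho n \<alpha> = \<rho> \<and> mat_rank (hankel_mat (n1 n) (n2 n) \<alpha>) \<le> r}"

text \<open>
  In the new coordinates the set becomes a condition on the prefix and a block of zeros. The
  discrepancies below \<open>\<rho>\<close> vanish for every tuple, so only those from \<open>\<rho>\<close> on, at positions from
  \<open>2 * \<rho>\<close> on, are constraints; the bound on \<open>r\<close> makes the vanishing below \<open>n_1\<close> a part of the
  condition on the rank.
\<close>

lemma hankel_tuples_rho_le_iff:
  fixes \<alpha> :: "'a :: {field, finite} vec"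
  assumes \<rho>: "\<rho> < n1 n" and r: "\<rho> \<le> r" "r \<le> n + 1 - n1 n"
  shows "\<alpha> \<in> hankel_tuples_rho_le n h \<rho> r \<longleftrightarrow> \<alpha> \<in> hankel_nonsing (n + 1) h \<rho> \<and>
    (\<forall>i. 2 * \<rho> \<le> i \<longrightarrow> i < n + 1 - r + \<rho> \<longrightarrow> discrepancies (n + 1) \<rho> \<alpha> $ i = 0)"
proof (cases "det (hankel_mat \<rho> \<rho> \<alpha>) = 0")
  case True
  then show ?thesis by (auto simp: hankel_tuples_rho_le_def hankel_nonsing_def hankel_rho_eq_iff)
next
  case False
  let ?d = "\<lambda>i. moment (vec_index \<alpha>) (monom 1 i * orthogonal_poly \<alpha> \<rho>)"
  have p: "monic_orthogonal (vec_index \<alpha>) \<rho> (orthogonal_poly \<alpha> \<rho>)"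
    using False by (rule monic_orthogonal_orthogonal_poly)
  have "hankel_rho n \<alpha> = \<rho> \<and> mat_rank (hankel_mat (n1 n) (n2 n) \<alpha>) \<le> r \<longleftrightarrow>
      (\<forall>i<n + 1 - r. ?d i = 0)"
    using hankel_rho_eq_iff_discrepancies[OF less_imp_le[OF \<rho>] False p]
      rank_hankel_mat_le_iff[OF _ \<rho> p r] r by (auto simp: n1_def)
  also have "\<dots> \<longleftrightarrow> (\<forall>i. \<rho> \<le> i \<longrightarrow> i < n + 1 - r \<longrightarrow> ?d i = 0)"
    using p by (auto simp: monic_orthogonal_def) (metis not_le)
  also have "\<dots> \<longleftrightarrow> (\<forall>i. 2 * \<rho> \<le> i \<longrightarrow> i < n + 1 - r + \<rho> \<longrightarrow> discrepancies (n + 1) \<rho> \<alpha> $ i = 0)"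
    (is "?A \<longleftrightarrow> ?B")
  proof
    show ?B if ?A
      using that r by (auto simp: discrepancies_def)
    show ?A if B: ?B
    proof (intro allI impI)
      fix i assume "\<rho> \<le> i" "i < n + 1 - r"
      then show "?d i = 0"
        using B[rule_format, of "i + \<rho>"] r by (simp add: discrepancies_def)
    qed
  qed
  finally show ?thesis
    using False by (auto simp: hankel_tuples_rho_le_def hankel_nonsing_def)
qed

lemma card_hankel_tuples_rho_le:
  assumes \<rho>: "\<rho> < n1 n" and r: "\<rho> \<le> r" "r \<le> n + 1 - n1 n" and h: "h \<le> n + 1"
  shows "card (hankel_tuples_rho_le n h \<rho> r :: 'a :: {field, finite} vec set) =
    card {\<alpha> \<in> hankel_nonsing (n + 1) h \<rho> :: 'a vec set.
      \<forall>i. 2 * \<rho> \<le> i \<longrightarrow> i < n + 1 - r + \<rho> \<longrightarrow> \<alpha> $ i = 0}"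
proof -
  let ?D = "hankel_nonsing (n + 1) h \<rho> :: 'a vec set"
  let ?Z = "\<lambda>\<alpha> :: 'a vec. \<forall>i. 2 * \<rho> \<le> i \<longrightarrow> i < n + 1 - r + \<rho> \<longrightarrow> \<alpha> $ i = 0"
  have bij: "bij_betw (discrepancies (n + 1) \<rho>) ?D ?D"
    using \<rho> h by (intro bij_betw_discrepancies) (auto simp: n1_def)
  have "hankel_tuples_rho_le n h \<rho> r = {\<alpha> \<in> ?D. ?Z (discrepancies (n + 1) \<rho> \<alpha>)}"
    by (intro Set.set_eqI) (simp only: hankel_tuples_rho_le_iff[OF \<rho> r] mem_Collect_eq)
  moreover have "bij_betw (discrepancies (n + 1) \<rho>) {\<alpha> \<in> ?D. ?Z (discrepancies (n + 1) \<rho> \<alpha>)} {\<alpha> \<in> ?D. ?Z \<alpha>}"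
  proof (rule bij_betw_subset[OF bij])
    show "discrepancies (n + 1) \<rho> ` {\<alpha> \<in> ?D. ?Z (discrepancies (n + 1) \<rho> \<alpha>)} = {\<alpha> \<in> ?D. ?Z \<alpha>}"
    proof -
      have "f ` {x \<in> A. Z (f x)} = {y \<in> f ` A. Z y}" for f :: "'a vec \<Rightarrow> 'a vec" and A Z
        by auto
      from this[of "discrepancies (n + 1) \<rho>" ?D ?Z] show ?thesis
        unfolding bij_betw_imp_surj_on[OF bij] .
    qed
  qed auto
  ultimately show ?thesis by (simp only: bij_betw_same_card)
qed

lemma card_hankel_tuples_rho_le_0:
  assumes r: "r \<le> n + 1 - n1 n" and h: "h \<le> n + 1"
  shows "card (hankel_tuples_rho_le n h 0 r :: 'a :: {field, finite} vec set) =
    CARD('a) ^ min r (n + 1 - h)"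
proof -
  have "card (hankel_tuples_rho_le n h 0 r :: 'a vec set) =
      card {\<alpha> \<in> hankel_nonsing (n + 1) h 0 :: 'a vec set.
        \<forall>i. 2 * 0 \<le> i \<longrightarrow> i < n + 1 - r + 0 \<longrightarrow> \<alpha> $ i = 0}"
    by (rule card_hankel_tuples_rho_le[OF _ _ r h]) (simp_all add: n1_def)
  also have "{\<alpha> \<in> hankel_nonsing (n + 1) h 0 :: 'a vec set.
        \<forall>i. 2 * 0 \<le> i \<longrightarrow> i < n + 1 - r + 0 \<longrightarrow> \<alpha> $ i = 0} =
      {\<alpha> \<in> carrier_vec (n + 1). \<forall>i<max h (n + 1 - r). \<alpha> $ i = 0}"
    by (auto simp: hankel_nonsing_def det_dim_zero[OF hankel_mat_carrier] less_max_iff_disj)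
  also have "card \<dots> = CARD('a) ^ (n + 1 - max h (n + 1 - r))"
    by (rule card_vecs_zero_prefix) (use h in simp)
  also have "n + 1 - max h (n + 1 - r) = min r (n + 1 - h)"
    using r h by (auto simp: n1_def)
  finally show ?thesis .
qed

lemma card_hankel_tuples_rho_le_pos:
  assumes \<rho>: "0 < \<rho>" "\<rho> < n1 n" and r: "\<rho> \<le> r" "r \<le> n + 1 - n1 n" and h: "h < \<rho>"
  shows "card (hankel_tuples_rho_le n h \<rho> r :: 'a :: {field, finite} vec set) =
    card (hankel_nonsing (2 * \<rho>) h \<rho> :: 'a vec set) * CARD('a) ^ (r - \<rho>)"
proof -
  have hn: "h \<le> n + 1" using \<rho> h by (simp add: n1_def)
  have "card (hankel_tuples_rho_le n h \<rho> r :: 'a vec set) =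
      card {\<alpha> \<in> hankel_nonsing (n + 1) h \<rho> :: 'a vec set.
        \<forall>i. 2 * \<rho> \<le> i \<longrightarrow> i < n + 1 - r + \<rho> \<longrightarrow> \<alpha> $ i = 0}"
    by (rule card_hankel_tuples_rho_le[OF \<rho>(2) r hn])
  also have "\<dots> = card (hankel_nonsing (2 * \<rho>) h \<rho> :: 'a vec set) * CARD('a) ^ (n + 1 - (n + 1 - r + \<rho>))"
    by (rule card_hankel_nonsing_prefix) (use \<rho> r h in \<open>auto simp: n1_def\<close>)
  also have "n + 1 - (n + 1 - r + \<rho>) = r - \<rho>" using r by (simp add: n1_def)
  finally show ?thesis .
qed

lemma hankel_tuples_rho_le_empty:
  assumes "0 < \<rho>" "\<rho> \<le> h"
  shows "hankel_tuples_rho_le n h \<rho> r = {}"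
  using assms det_hankel_zero_prefix
  by (auto simp: hankel_tuples_rho_le_def hankel_rho_eq_iff)

section \<open>Cumulative counts by rank\<close>

definition hankel_tuples_le :: "nat \<Rightarrow> nat \<Rightarrow> nat \<Rightarrow> 'a :: field vec set" where
  "hankel_tuples_le n h k = {\<alpha> \<in> carrier_vec (n + 1).
     mat_rank (hankel_mat (n1 n) (n2 n) \<alpha>) \<le> k \<and> (\<forall>i<h. \<alpha> $ i = 0)}"

lemma finite_vecs [simp]: "finite {\<alpha> \<in> carrier_vec N. P (\<alpha> :: 'a :: finite vec)}"
  by (rule finite_subset[OF _ finite_carrier_vec[of N]]) auto

lemma finite_hankel_sets [simp]:
  "finite (hankel_tuples_le n h k :: 'a :: {field, finite} vec set)"
  "finite (hankel_tuples_rho_le n h \<rho> k :: 'a vec set)"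
  "finite (hankel_nonsing n h k :: 'a vec set)"
  "finite (hankel_tuples n h k :: 'a vec set)"
  by (simp_all add: hankel_tuples_le_def hankel_tuples_rho_le_def hankel_nonsing_def hankel_tuples_def)

lemma geometric_sum_nat:
  fixes q :: nat
  assumes "1 \<le> q"
  shows "q ^ k + (\<Sum>j<m. (q - 1) * q ^ (k + j)) = q ^ (k + m)"
proof -
  obtain p where "q = Suc p" using assms by (cases q) auto
  then show ?thesis by (induction m) (auto simp: algebra_simps)
qed

text \<open>
  The contributions of the invariants \<open>h < \<rho> \<le> k\<close> form a geometric series that telescopes once the
  contribution \<open>q ^ k\<close> of \<open>\<rho> = 0\<close> is added.
\<close>

lemma sum_rho_contributions:
  fixes q :: nat
  assumes "1 \<le> q" "h \<le> k"
  shows "q ^ k + (\<Sum>\<rho>\<in>{h<..k}. (q - 1) * q ^ (\<rho> + k - 1 - h)) = q ^ (2 * k - h)"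
proof -
  have "(\<Sum>\<rho>\<in>{h<..k}. (q - 1) * q ^ (\<rho> + k - 1 - h)) = (\<Sum>j<k - h. (q - 1) * q ^ (k + j))"
    by (rule sum.reindex_bij_witness[where i = "\<lambda>j. j + h + 1" and j = "\<lambda>\<rho>. \<rho> - h - 1"])
      (auto intro!: arg_cong[where f = "\<lambda>i. q ^ i"])
  then show ?thesis using geometric_sum_nat[OF assms(1), of k "k - h"] assms(2) by (simp add: mult_2)
qed

lemma card_hankel_tuples_rho_le_formula:
  assumes M: "card (hankel_nonsing (2 * \<rho>) h \<rho> :: 'a :: {field, finite} vec set) =
      (CARD('a) - 1) * CARD('a) ^ (2 * \<rho> - 1 - h)"
    and \<rho>: "\<rho> < n1 n" and r: "\<rho> \<le> r" "r \<le> n + 1 - n1 n" and h: "h < \<rho>"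
  shows "card (hankel_tuples_rho_le n h \<rho> r :: 'a vec set) =
    (CARD('a) - 1) * CARD('a) ^ (\<rho> + r - 1 - h)"
proof -
  have "2 * \<rho> - 1 - h + (r - \<rho>) = \<rho> + r - 1 - h" using r h by simp
  then show ?thesis
    using card_hankel_tuples_rho_le_pos[of \<rho> n r h, where 'a = 'a] M assms(2-)
    by (simp add: mult.assoc flip: power_add)
qed

text \<open>
  Split by the invariant, which is at most the rank. The count of nonsingular prefixes is a hypothesis,
  for \<open>\<rho> \<le> k\<close> only, so that the lemma can serve in the induction that establishes that count.
\<close>

lemma card_hankel_tuples_le_aux:
  assumes M: "\<And>\<rho>. h < \<rho> \<Longrightarrow> \<rho> \<le> k \<Longrightarrow> card (hankel_nonsing (2 * \<rho>) h \<rho> :: 'a :: {field, finite} vec set) =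
      (CARD('a) - 1) * CARD('a) ^ (2 * \<rho> - 1 - h)"
    and k: "k < n1 n" and h: "h \<le> n + 1"
  shows "card (hankel_tuples_le n h k :: 'a vec set) =
    (if h \<le> k then CARD('a) ^ (2 * k - h) else CARD('a) ^ min k (n + 1 - h))"
proof -
  let ?f = "\<lambda>\<rho>. card (hankel_tuples_rho_le n h \<rho> k :: 'a vec set)"
  have kn: "k \<le> n + 1 - n1 n" using k by (simp add: n1_def)
  have "(hankel_tuples_le n h k :: 'a vec set) = (\<Union>\<rho>\<in>{..k}. hankel_tuples_rho_le n h \<rho> k)"
    using order_trans[OF hankel_rho_le_rank] by (auto simp: hankel_tuples_le_def hankel_tuples_rho_le_def)
  then have "card (hankel_tuples_le n h k :: 'a vec set) = (\<Sum>\<rho>\<le>k. ?f \<rho>)"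
    by (simp only:) (rule card_UN_disjoint, auto simp: hankel_tuples_rho_le_def)
  also have "\<dots> = (\<Sum>\<rho>\<in>insert 0 {h<..k}. ?f \<rho>)"
    by (rule sum.mono_neutral_right) (auto simp: hankel_tuples_rho_le_empty not_less)
  also have "\<dots> = ?f 0 + (\<Sum>\<rho>\<in>{h<..k}. ?f \<rho>)" by simp
  also have "(\<Sum>\<rho>\<in>{h<..k}. ?f \<rho>) = (\<Sum>\<rho>\<in>{h<..k}. (CARD('a) - 1) * CARD('a) ^ (\<rho> + k - 1 - h))"
    using M k kn by (intro sum.cong refl card_hankel_tuples_rho_le_formula) auto
  also have "?f 0 = CARD('a) ^ min k (n + 1 - h)"
    by (rule card_hankel_tuples_rho_le_0[OF kn h])
  finally have total: "card (hankel_tuples_le n h k :: 'a vec set) = CARD('a) ^ min k (n + 1 - h) +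
    (\<Sum>\<rho>\<in>{h<..k}. (CARD('a) - 1) * CARD('a) ^ (\<rho> + k - 1 - h))" .
  show ?thesis
  proof (cases "h \<le> k")
    case True
    have "min k (n + 1 - h) = k" using True k by (simp add: n1_def)
    then show ?thesis
      using total True sum_rho_contributions[of "CARD('a)" h k] one_less_card_field[where 'a = 'a] by simp
  next
    case False
    then show ?thesis using total by simp
  qed
qed

text \<open>
  For \<open>n = 2 * \<rho> - 2\<close> the almost square Hankel matrix is the square one of size \<open>\<rho>\<close> and uses the whole
  tuple. Removing the singular ones, those of rank at most \<open>\<rho> - 1\<close>, needs only the counts for smaller
  sizes.
\<close>

lemma card_hankel_nonsing_square:
  assumes M: "\<And>\<rho>'. h < \<rho>' \<Longrightarrow> \<rho>' < \<rho> \<Longrightarrow> card (hankel_nonsing (2 * \<rho>') h \<rho>' :: 'a :: {field, finite} vec set) =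
      (CARD('a) - 1) * CARD('a) ^ (2 * \<rho>' - 1 - h)"
    and h: "h < \<rho>"
  shows "card (hankel_nonsing (2 * \<rho> - 1) h \<rho> :: 'a vec set) =
    (CARD('a) - 1) * CARD('a) ^ (2 * \<rho> - 2 - h)"
proof -
  define n where "n = 2 * \<rho> - 2"
  have n: "n + 1 = 2 * \<rho> - 1" "n1 n = \<rho>" "n2 n = \<rho>" "h \<le> n + 1"
    using h by (auto simp: n_def n1_def n2_def)
  have "det (hankel_mat \<rho> \<rho> \<alpha>) = 0 \<longleftrightarrow> mat_rank (hankel_mat \<rho> \<rho> \<alpha>) \<le> \<rho> - 1" for \<alpha> :: "'a vec"
    using vec_space.det_rank_iff[OF hankel_mat_carrier[of \<rho> \<rho> \<alpha>]]
      vec_space.rank_le_nc[OF hankel_mat_carrier[of \<rho> \<rho> \<alpha>]] h by auto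
  then have "{\<alpha> \<in> carrier_vec (n + 1). \<forall>i<h. \<alpha> $ i = 0} =
      hankel_nonsing (n + 1) h \<rho> \<union> (hankel_tuples_le n h (\<rho> - 1) :: 'a vec set)"
    and "hankel_nonsing (n + 1) h \<rho> \<inter> (hankel_tuples_le n h (\<rho> - 1) :: 'a vec set) = {}"
    by (auto simp: hankel_nonsing_def hankel_tuples_le_def n)
  then have "card {\<alpha> :: 'a vec \<in> carrier_vec (n + 1). \<forall>i<h. \<alpha> $ i = 0} =
      card (hankel_nonsing (n + 1) h \<rho> :: 'a vec set) + card (hankel_tuples_le n h (\<rho> - 1) :: 'a vec set)"
    by (simp only: card_Un_disjoint finite_hankel_sets)
  moreover have "card (hankel_tuples_le n h (\<rho> - 1) :: 'a vec set) = CARD('a) ^ (2 * \<rho> - 2 - h)"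
  proof -
    have "h \<le> \<rho> - 1" "2 * (\<rho> - 1) = 2 * \<rho> - 2" using h by auto
    then show ?thesis
      using card_hankel_tuples_le_aux[of h "\<rho> - 1" n, where 'a = 'a] M n h by simp
  qed
  moreover have "n + 1 - h = Suc (2 * \<rho> - 2 - h)" using h by (simp add: n_def)
  ultimately show ?thesis
    using card_vecs_zero_prefix[OF n(4), where 'a = 'a] n(1)
    by (simp add: diff_mult_distrib add_implies_diff)
qed

text \<open>
  Exactly the fraction \<open>1 - 1/q\<close> of all tuples with \<open>h < \<rho>\<close> leading zeros has a nonsingular leading
  \<open>\<rho> \<times> \<rho>\<close> Hankel matrix. The determinant depends on the first \<open>2 * \<rho> - 1\<close> entries only, the remaining ones
  are free.
\<close>

lemma card_hankel_nonsing:
  assumes "h < \<rho>" "2 * \<rho> \<le> N + 1"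
  shows "card (hankel_nonsing N h \<rho> :: 'a :: {field, finite} vec set) =
    (CARD('a) - 1) * CARD('a) ^ (N - 1 - h)"
  using assms
proof (induction \<rho> arbitrary: N rule: less_induct)
  case (less \<rho>)
  have "card (hankel_nonsing N h \<rho> :: 'a vec set) =
      card {\<alpha> \<in> hankel_nonsing N h \<rho> :: 'a vec set. \<forall>i. 2 * \<rho> - 1 \<le> i \<longrightarrow> i < 2 * \<rho> - 1 \<longrightarrow> \<alpha> $ i = 0}"
    by (intro arg_cong[where f = card]) auto
  also have "\<dots> = card (hankel_nonsing (2 * \<rho> - 1) h \<rho> :: 'a vec set) * CARD('a) ^ (N - (2 * \<rho> - 1))"
    by (rule card_hankel_nonsing_prefix) (use less.prems in auto)
  also have "card (hankel_nonsing (2 * \<rho> - 1) h \<rho> :: 'a vec set) =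
      (CARD('a) - 1) * CARD('a) ^ (2 * \<rho> - 2 - h)"
    by (rule card_hankel_nonsing_square) (use less in auto)
  also have "\<dots> * CARD('a) ^ (N - (2 * \<rho> - 1)) =
      (CARD('a) - 1) * CARD('a) ^ ((2 * \<rho> - 2 - h) + (N - (2 * \<rho> - 1)))"
    by (simp add: power_add)
  also have "(2 * \<rho> - 2 - h) + (N - (2 * \<rho> - 1)) = N - 1 - h" using less.prems by linarith
  finally show ?case .
qed

lemma card_hankel_tuples_rho_le_eq:
  assumes "\<rho> < n1 n" "\<rho> \<le> r" "r \<le> n + 1 - n1 n" "h < \<rho>"
  shows "card (hankel_tuples_rho_le n h \<rho> r :: 'a :: {field, finite} vec set) =
    (CARD('a) - 1) * CARD('a) ^ (\<rho> + r - 1 - h)"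
  using assms by (intro card_hankel_tuples_rho_le_formula card_hankel_nonsing) auto

lemma card_hankel_tuples_le:
  assumes h: "h \<le> n + 1"
  shows "card (hankel_tuples_le n h k :: 'a :: {field, finite} vec set) = CARD('a) ^
    (if n1 n \<le> k then n + 1 - h else if h \<le> k then 2 * k - h else min k (n + 1 - h))"
proof (cases "n1 n \<le> k")
  case True
  then have "hankel_tuples_le n h k = {\<alpha> :: 'a vec \<in> carrier_vec (n + 1). \<forall>i<h. \<alpha> $ i = 0}"
    using order_trans[OF rank_hankel_mat_le_n1 True] by (auto simp: hankel_tuples_le_def)
  then show ?thesis using True card_vecs_zero_prefix[OF h, where 'a = 'a] by simp
next
  case False
  have "card (hankel_tuples_le n h k :: 'a vec set) =
    (if h \<le> k then CARD('a) ^ (2 * k - h) else CARD('a) ^ min k (n + 1 - h))"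
    using False h by (intro card_hankel_tuples_le_aux card_hankel_nonsing) auto
  then show ?thesis using False by simp
qed

text \<open>
  Exact ranks are differences of consecutive cumulative counts; the sum form avoids truncated subtraction.
\<close>

lemma card_hankel_tuples:
  "card (hankel_tuples n h 0 :: 'a :: {field, finite} vec set) = card (hankel_tuples_le n h 0 :: 'a vec set)"
  "card (hankel_tuples n h (Suc k) :: 'a vec set) + card (hankel_tuples_le n h k :: 'a vec set) =
    card (hankel_tuples_le n h (Suc k) :: 'a vec set)"
proof -
  show "card (hankel_tuples n h 0 :: 'a vec set) = card (hankel_tuples_le n h 0 :: 'a vec set)"
    by (simp add: hankel_tuples_def hankel_tuples_le_def)
  have "hankel_tuples_le n h (Suc k) = hankel_tuples n h (Suc k) \<union> (hankel_tuples_le n h k :: 'a vec set)"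
    and "hankel_tuples n h (Suc k) \<inter> (hankel_tuples_le n h k :: 'a vec set) = {}"
    by (auto simp: hankel_tuples_def hankel_tuples_le_def)
  then show "card (hankel_tuples n h (Suc k) :: 'a vec set) + card (hankel_tuples_le n h k :: 'a vec set) =
      card (hankel_tuples_le n h (Suc k) :: 'a vec set)"
    by (simp only: card_Un_disjoint finite_hankel_sets)
qed

lemma hankel_tuples_rho_pi_eq:
  "hankel_tuples_rho_pi n h (\<rho> + \<pi>) \<rho> \<pi> = {\<alpha> \<in> carrier_vec (n + 1). (\<forall>i<h. \<alpha> $ i = 0) \<and>
     hankel_rho n \<alpha> = \<rho> \<and> mat_rank (hankel_mat (n1 n) (n2 n) \<alpha>) = \<rho> + \<pi>}"
  by (auto simp: hankel_tuples_rho_pi_def hankel_tuples_def hankel_pi_def)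

lemma card_hankel_tuples_rho_pi:
  "card (hankel_tuples_rho_pi n h \<rho> \<rho> 0 :: 'a :: {field, finite} vec set) =
    card (hankel_tuples_rho_le n h \<rho> \<rho> :: 'a vec set)"
  "card (hankel_tuples_rho_pi n h (\<rho> + Suc \<pi>) \<rho> (Suc \<pi>) :: 'a vec set) +
    card (hankel_tuples_rho_le n h \<rho> (\<rho> + \<pi>) :: 'a vec set) =
    card (hankel_tuples_rho_le n h \<rho> (\<rho> + Suc \<pi>) :: 'a vec set)"
proof -
  have "hankel_tuples_rho_pi n h \<rho> \<rho> 0 = (hankel_tuples_rho_le n h \<rho> \<rho> :: 'a vec set)"
    using hankel_tuples_rho_pi_eq[of n h \<rho> 0] hankel_rho_le_rank
    by (auto simp: hankel_tuples_rho_le_def intro: antisym)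
  then show "card (hankel_tuples_rho_pi n h \<rho> \<rho> 0 :: 'a vec set) =
    card (hankel_tuples_rho_le n h \<rho> \<rho> :: 'a vec set)" by simp
  have fin: "finite (hankel_tuples_rho_pi n h (\<rho> + Suc \<pi>) \<rho> (Suc \<pi>) :: 'a vec set)"
    by (simp only: hankel_tuples_rho_pi_eq finite_vecs)
  have "hankel_tuples_rho_le n h \<rho> (\<rho> + Suc \<pi>) = hankel_tuples_rho_pi n h (\<rho> + Suc \<pi>) \<rho> (Suc \<pi>) \<union>
      (hankel_tuples_rho_le n h \<rho> (\<rho> + \<pi>) :: 'a vec set)"
    and "hankel_tuples_rho_pi n h (\<rho> + Suc \<pi>) \<rho> (Suc \<pi>) \<inter>
      (hankel_tuples_rho_le n h \<rho> (\<rho> + \<pi>) :: 'a vec set) = {}"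
    unfolding hankel_tuples_rho_pi_eq by (auto simp: hankel_tuples_rho_le_def)
  then show "card (hankel_tuples_rho_pi n h (\<rho> + Suc \<pi>) \<rho> (Suc \<pi>) :: 'a vec set) +
    card (hankel_tuples_rho_le n h \<rho> (\<rho> + \<pi>) :: 'a vec set) =
    card (hankel_tuples_rho_le n h \<rho> (\<rho> + Suc \<pi>) :: 'a vec set)"
    using fin by (simp only: card_Un_disjoint finite_hankel_sets)
qed

section \<open>The counts for each part of the classification\<close>

lemma n1_bounds: "0 < n1 n" "n1 n - 1 \<le> n + 1 - n1 n" "n + 1 - n1 n \<le> n1 n" "2 * n1 n \<le> n + 2" "n1 n \<le> n + 1" "n + 1 \<le> 2 * n1 n"
  by (auto simp: n1_def)

text \<open>
  The two parities express one bound: of the \<open>n + 1 - \<rho>\<close> discrepancies of a tuple the first \<open>n_1\<close>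
  vanish, which leaves \<open>n + 1 - \<rho> - n_1\<close> of them.
\<close>

lemma parity_bound_iff:
  assumes "\<rho> < n1 n"
  shows "(even n \<longrightarrow> \<pi> \<le> n1 n - \<rho> - 1) \<and> (odd n \<longrightarrow> \<pi> \<le> n1 n - \<rho>) \<longleftrightarrow> \<rho> + \<pi> \<le> n + 1 - n1 n"
  using assms by (cases "even n") (auto simp: n1_def elim!: evenE oddE)

lemma hankel_tuples_rho_pi_rank_le:
  fixes h :: nat
  assumes "(hankel_tuples_rho_pi n h (\<rho> + \<pi>) \<rho> \<pi> :: 'a :: {field, finite} vec set) \<noteq> {}" "\<rho> < n1 n"
  shows "\<rho> + \<pi> \<le> n + 1 - n1 n"
  using assms rank_le_of_hankel_rho_less unfolding hankel_tuples_rho_pi_eq by fastforce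

text \<open>
  Beyond \<open>r = n + 1 - h\<close> the cumulative counts no longer grow: a tuple with invariant 0 has as its rank the
  number of entries from the first nonzero one on, and the first \<open>h\<close> entries are zero.
\<close>

lemma hankel_tuples_rho_zero_nonempty:
  assumes ne: "(hankel_tuples_rho_pi n h r 0 r :: 'a :: {field, finite} vec set) \<noteq> {}" and h: "h \<le> n + 1"
  shows "r \<le> n + 1 - n1 n" "r \<le> n + 1 - h"
proof -
  show r: "r \<le> n + 1 - n1 n"
    using hankel_tuples_rho_pi_rank_le[of n h 0 r, where 'a = 'a] ne n1_bounds by simp
  show "r \<le> n + 1 - h"
  proof (rule ccontr)
    assume n: "\<not> r \<le> n + 1 - h"
    then obtain k where k: "r = Suc k" by (cases r) auto
    have "card (hankel_tuples_rho_pi n h r 0 r :: 'a vec set) = 0"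
      using card_hankel_tuples_rho_pi(2)[of n h 0 k, where 'a = 'a] n k r h
      by (simp add: card_hankel_tuples_rho_le_0)
    moreover have "finite (hankel_tuples_rho_pi n h (0 + r) 0 r :: 'a vec set)"
      by (simp only: hankel_tuples_rho_pi_eq finite_vecs)
    ultimately show False using ne by simp
  qed
qed

lemma card_hankel_tuples_rho_zero:
  assumes "r \<le> n + 1 - n1 n" "r \<le> n + 1 - h" "h \<le> n + 1"
  shows "card (hankel_tuples_rho_pi n h r 0 r :: 'a :: {field, finite} vec set) =
    (if r = 0 then 1 else (CARD('a) - 1) * CARD('a) ^ (r - 1))"
proof (cases r)
  case 0
  then show ?thesis
    using card_hankel_tuples_rho_pi(1)[of n h 0, where 'a = 'a] assms
    by (simp add: card_hankel_tuples_rho_le_0)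
next
  case (Suc k)
  then show ?thesis
    using card_hankel_tuples_rho_pi(2)[of n h 0 k, where 'a = 'a] assms
    by (simp add: card_hankel_tuples_rho_le_0 diff_mult_distrib add_implies_diff)
qed

lemma hankel_tuples_rho_pos_nonempty:
  assumes "(hankel_tuples_rho_pi n h (\<rho> + \<pi>) \<rho> \<pi> :: 'a :: field vec set) \<noteq> {}" "0 < \<rho>"
  shows "h < \<rho>"
proof (rule ccontr)
  assume "\<not> h < \<rho>"
  moreover obtain \<alpha> :: "'a vec" where "\<And>i. i < h \<Longrightarrow> \<alpha> $ i = 0" "hankel_rho n \<alpha> = \<rho>"
    using assms(1) unfolding hankel_tuples_rho_pi_eq by auto
  ultimately show False
    using assms(2) det_hankel_zero_prefix[of \<rho> h \<alpha>] by (simp add: hankel_rho_eq_iff)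
qed

lemma card_hankel_tuples_rho_pos:
  assumes "\<rho> < n1 n" "\<rho> + \<pi> \<le> n + 1 - n1 n" "h < \<rho>"
  shows "card (hankel_tuples_rho_pi n h (\<rho> + \<pi>) \<rho> \<pi> :: 'a :: {field, finite} vec set) =
    (if \<pi> = 0 then (CARD('a) - 1) * CARD('a) ^ (2 * \<rho> - h - 1)
     else (CARD('a) - 1)\<^sup>2 * CARD('a) ^ (2 * \<rho> + \<pi> - h - 2))"
proof (cases \<pi>)
  case 0
  then show ?thesis
    using card_hankel_tuples_rho_pi(1)[of n h \<rho>, where 'a = 'a] assms
    by (simp add: card_hankel_tuples_rho_le_eq mult_2)
next
  case (Suc k)
  \<comment> \<open>the cumulative counts up to \<open>\<pi> - 1\<close> and \<open>\<pi>\<close> have the exponents \<open>e\<close> and \<open>e + 1\<close>\<close>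
  define e where "e = 2 * \<rho> + \<pi> - h - 2"
  have e: "\<rho> + (\<rho> + k) - 1 - h = e" "\<rho> + (\<rho> + Suc k) - 1 - h = Suc e"
    using assms Suc by (auto simp: e_def)
  have le: "card (hankel_tuples_rho_le n h \<rho> (\<rho> + k) :: 'a vec set) = (CARD('a) - 1) * CARD('a) ^ e"
    "card (hankel_tuples_rho_le n h \<rho> (\<rho> + Suc k) :: 'a vec set) = (CARD('a) - 1) * CARD('a) ^ Suc e"
    using card_hankel_tuples_rho_le_eq[of \<rho> n "\<rho> + k" h, where 'a = 'a]
      card_hankel_tuples_rho_le_eq[of \<rho> n "\<rho> + Suc k" h, where 'a = 'a] assms Suc
    unfolding e by auto
  obtain c where c: "CARD('a) = Suc c" using one_less_card_field[where 'a = 'a] by (cases "CARD('a)") auto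
  have "card (hankel_tuples_rho_pi n h (\<rho> + Suc k) \<rho> (Suc k) :: 'a vec set) + c * Suc c ^ e = c * Suc c ^ Suc e"
    using card_hankel_tuples_rho_pi(2)[of n h \<rho> k, where 'a = 'a] unfolding le unfolding c by simp
  then have "card (hankel_tuples_rho_pi n h (\<rho> + Suc k) \<rho> (Suc k) :: 'a vec set) = c\<^sup>2 * Suc c ^ e"
    by (simp add: power2_eq_square algebra_simps)
  then show ?thesis using Suc unfolding e_def[symmetric] by (simp add: c)
qed

lemma hankel_tuples_rho_max_nonempty:
  assumes "\<alpha> \<in> (hankel_tuples_rho_pi n h r (n1 n) \<pi> :: 'a :: {field, finite} vec set)"
  shows "r = n1 n \<and> \<pi> = 0 \<and> h + 1 \<le> n1 n"
proof -
  have \<alpha>: "\<And>i. i < h \<Longrightarrow> \<alpha> $ i = 0" "hankel_rho n \<alpha> = n1 n"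
    and r: "mat_rank (hankel_mat (n1 n) (n2 n) \<alpha>) = r" "hankel_pi n \<alpha> = \<pi>"
    using assms by (auto simp: hankel_tuples_rho_pi_def hankel_tuples_def)
  have "mat_rank (hankel_mat (n1 n) (n2 n) \<alpha>) = n1 n"
    using hankel_rho_le_rank[of n \<alpha>] rank_hankel_mat_le_n1[of n \<alpha>] \<alpha>(2) by simp
  moreover have "h < n1 n"
    using \<alpha> det_hankel_zero_prefix[of "n1 n" h \<alpha>] n1_bounds(1)[of n]
    by (cases "h < n1 n") (auto simp: hankel_rho_eq_iff)
  ultimately show ?thesis using r \<alpha>(2) by (simp add: hankel_pi_def)
qed

lemma card_hankel_tuples_rho_max:
  assumes "h < n1 n"
  shows "card (hankel_tuples_rho_pi n h (n1 n) (n1 n) 0 :: 'a :: {field, finite} vec set) =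
    (CARD('a) - 1) * CARD('a) ^ (n - h)"
proof -
  have "hankel_rho n \<alpha> = n1 n \<and> mat_rank (hankel_mat (n1 n) (n2 n) \<alpha>) = n1 n \<longleftrightarrow>
      det (hankel_mat (n1 n) (n1 n) \<alpha>) \<noteq> 0" for \<alpha> :: "'a vec"
  proof -
    have "hankel_rho n \<alpha> = n1 n \<longleftrightarrow> det (hankel_mat (n1 n) (n1 n) \<alpha>) \<noteq> 0"
      by (simp add: hankel_rho_eq_iff)
    then show ?thesis
      using hankel_rho_le_rank[of n \<alpha>] rank_hankel_mat_le_n1[of n \<alpha>] by auto
  qed
  then have "hankel_tuples_rho_pi n h (n1 n) (n1 n) 0 = (hankel_nonsing (n + 1) h (n1 n) :: 'a vec set)"
    using hankel_tuples_rho_pi_eq[of n h "n1 n" 0, where 'a = 'a] by (simp add: hankel_nonsing_def)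
  then show ?thesis
    using card_hankel_nonsing[of h "n1 n" "n + 1", where 'a = 'a] assms n1_bounds(4)[of n] by simp
qed

text \<open>
  With \<open>e k\<close> the exponent of the cumulative count for rank at most \<open>k\<close>, every case is
  \<open>q ^ e r - q ^ e (r - 1)\<close>; the ranks that do not occur are those with \<open>e r = e (r - 1)\<close>.
\<close>

lemma card_hankel_tuples_formula:
  fixes h :: nat
  assumes h: "h \<le> n + 1"
  defines "q \<equiv> int CARD('a :: {field, finite})"
  defines "L \<equiv> \<lambda>r. int (card (hankel_tuples n h r :: 'a vec set))"
  shows "r = 0 \<Longrightarrow> L r = 1"
    and "1 \<le> r \<Longrightarrow> r \<le> min h (n + 1 - h) \<Longrightarrow> L r = (q - 1) * q ^ (r - 1)"
    and "h + 1 \<le> r \<Longrightarrow> r \<le> n1 n - 1 \<Longrightarrow> L r = (q\<^sup>2 - 1) * q ^ (2 * r - h - 2)"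
    and "r = n1 n \<Longrightarrow> h + 1 \<le> n1 n \<Longrightarrow> L r = q ^ (n + 1 - h) - q ^ (2 * n1 n - h - 2)"
    and "\<not> (r = 0 \<or> (1 \<le> r \<and> r \<le> min h (n + 1 - h)) \<or> (h + 1 \<le> r \<and> r \<le> n1 n - 1) \<or>
            (r = n1 n \<and> h + 1 \<le> n1 n)) \<Longrightarrow> L r = 0"
proof -
  define e where "e k = (if n1 n \<le> k then n + 1 - h else if h \<le> k then 2 * k - h else min k (n + 1 - h))" for k
  have le: "int (card (hankel_tuples_le n h k :: 'a vec set)) = q ^ e k" for k
    unfolding e_def q_def card_hankel_tuples_le[OF h] by simp
  have step: "L r = q ^ e r - q ^ e (r - 1)" if "0 < r" for r
    using card_hankel_tuples(2)[of n h "r - 1", where 'a = 'a] that le[of r] le[of "r - 1"]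
    unfolding L_def by simp
  note nb = n1_bounds[of n]
  show "L r = 1" if "r = 0"
  proof -
    have "e 0 = 0" using nb by (simp add: e_def)
    then show ?thesis using that le[of 0] card_hankel_tuples(1)[of n h, where 'a = 'a] by (simp add: L_def)
  qed
  show "L r = (q - 1) * q ^ (r - 1)" if r: "1 \<le> r" "r \<le> min h (n + 1 - h)"
  proof -
    have "r \<le> h" "r \<le> n + 1 - h" using r(2) by auto
    then have "e r = Suc (r - 1)" "e (r - 1) = r - 1"
      using r(1) h nb by (auto simp: e_def)
    then show ?thesis using step[of r] r(1) by (cases r) (simp_all add: left_diff_distrib)
  qed
  show "L r = (q\<^sup>2 - 1) * q ^ (2 * r - h - 2)" if r: "h + 1 \<le> r" "r \<le> n1 n - 1"
  proof -
    have "e r = 2 + (2 * r - h - 2)" "e (r - 1) = 2 * r - h - 2"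
      using r nb by (auto simp: e_def)
    then show ?thesis using step[of r] r by (simp only: power_add) (simp add: left_diff_distrib)
  qed
  show "L r = q ^ (n + 1 - h) - q ^ (2 * n1 n - h - 2)" if r: "r = n1 n" "h + 1 \<le> n1 n"
  proof -
    have "e r = n + 1 - h" "e (r - 1) = 2 * n1 n - h - 2"
      using r nb by (auto simp: e_def)
    then show ?thesis using step[of r] r nb by simp
  qed
  show "L r = 0" if r: "\<not> (r = 0 \<or> (1 \<le> r \<and> r \<le> min h (n + 1 - h)) \<or> (h + 1 \<le> r \<and> r \<le> n1 n - 1) \<or>
            (r = n1 n \<and> h + 1 \<le> n1 n))"
  proof -
    have "e r = e (r - 1)"
    proof (cases "h < r")
      case True
      then have "n1 n \<le> r - 1" using r by linarith
      then show ?thesis by (simp add: e_def)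
    next
      case False
      then have "r \<le> h" "n + 1 - h < r" using r by auto
      then show ?thesis using nb by (auto simp: e_def)
    qed
    then show ?thesis using step[of r] r by simp
  qed
qed

text \<open>
  Every entry of the tuple appears in the first column or in the last row.
\<close>

lemma inj_on_hankel_mat:
  assumes "1 \<le> l" "1 \<le> m"
  shows "inj_on (hankel_mat l m) (carrier_vec (l + m - 1))"
proof
  fix \<alpha> \<beta> :: "'a vec"
  assume \<alpha>: "\<alpha> \<in> carrier_vec (l + m - 1)" and \<beta>: "\<beta> \<in> carrier_vec (l + m - 1)"
    and eq: "hankel_mat l m \<alpha> = hankel_mat l m \<beta>"
  show "\<alpha> = \<beta>"
  proof (rule eq_vecI)
    fix k assume "k < dim_vec \<beta>"
    then have k: "k < l + m - 1" using \<beta> by simp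
    define i where "i = min k (l - 1)"
    have "i < l" "k - i < m" "i + (k - i) = k" using k assms by (auto simp: i_def)
    then have "hankel_mat l m \<gamma> $$ (i, k - i) = \<gamma> $ k" for \<gamma> :: "'a vec"
      by (simp add: hankel_mat_def)
    then show "\<alpha> $ k = \<beta> $ k" using eq by metis
  qed (use \<alpha> \<beta> in auto)
qed

text \<open>
  By \<open>rank_hankel_mat_min\<close>, a rank below \<open>min l m\<close> is the rank of the almost square matrix of the same
  tuple, and full rank collects all tuples whose almost square matrix has rank at least \<open>min l m\<close>.
\<close>

lemma card_hankel_mats:
  assumes lm: "1 \<le> l" "1 \<le> m" "l + m - 2 = n" and h: "h \<le> n + 1"
  shows "r < min l m \<Longrightarrow> card (hankel_mats l m h r :: 'a :: {field, finite} mat set) =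
      card (hankel_tuples n h r :: 'a vec set)"
    and "r = min l m \<Longrightarrow> card (hankel_mats l m h r :: 'a mat set) +
      card (hankel_tuples_le n h (r - 1) :: 'a vec set) = CARD('a) ^ (n + 1 - h)"
    and "min l m < r \<Longrightarrow> hankel_mats l m h r = ({} :: 'a mat set)"
    and "finite (hankel_mats l m h r :: 'a mat set)"
proof -
  have n: "l + m - 1 = n + 1" "l + m = n + 2" using lm by auto
  let ?rank = "\<lambda>\<alpha> :: 'a vec. mat_rank (hankel_mat (n1 n) (n2 n) \<alpha>)"
  define S where "S = {\<alpha> \<in> carrier_vec (n + 1). min (min l m) (?rank \<alpha>) = r \<and> (\<forall>i<h. \<alpha> $ i = 0)}"
  have image: "hankel_mats l m h r = hankel_mat l m ` S"
    unfolding hankel_mats_def S_def n(1) rank_hankel_mat_min[OF n(2)] by auto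
  have fin: "finite S" unfolding S_def by (rule finite_vecs)
  have card: "card (hankel_mats l m h r :: 'a mat set) = card S"
    unfolding image
    by (rule card_image, rule inj_on_subset[OF inj_on_hankel_mat[OF lm(1,2)]]) (auto simp: S_def n)
  show "finite (hankel_mats l m h r :: 'a mat set)" unfolding image using fin by simp
  show "card (hankel_mats l m h r :: 'a mat set) = card (hankel_tuples n h r :: 'a vec set)" if "r < min l m"
    unfolding card S_def hankel_tuples_def using that by (intro arg_cong[where f = card]) auto
  show "hankel_mats l m h r = ({} :: 'a mat set)" if "min l m < r"
    unfolding image S_def using that by auto
  show "card (hankel_mats l m h r :: 'a mat set) +
      card (hankel_tuples_le n h (r - 1) :: 'a vec set) = CARD('a) ^ (n + 1 - h)" if r: "r = min l m"
  proof -
    have "min (min l m) k = r \<longleftrightarrow> \<not> k \<le> r - 1" for k using r lm by auto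
    then have "{\<alpha> :: 'a vec \<in> carrier_vec (n + 1). \<forall>i<h. \<alpha> $ i = 0} = S \<union> hankel_tuples_le n h (r - 1)"
      and "S \<inter> hankel_tuples_le n h (r - 1) = {}"
      unfolding S_def hankel_tuples_le_def by auto
    then have "card {\<alpha> :: 'a vec \<in> carrier_vec (n + 1). \<forall>i<h. \<alpha> $ i = 0} =
        card S + card (hankel_tuples_le n h (r - 1) :: 'a vec set)"
      using fin by (simp only: card_Un_disjoint finite_hankel_sets)
    then show ?thesis using card card_vecs_zero_prefix[OF h, where 'a = 'a] by simp
  qed
qed

text \<open>
  In the last case the tuples of rank at most \<open>min l m - 1\<close> are already all tuples with \<open>h\<close> leading zeros.
\<close>

lemma card_hankel_mats_full_rank:
  fixes h :: nat
  assumes lm: "1 \<le> l" "1 \<le> m" "l + m - 2 = n" and h: "h \<le> n + 1"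
  defines "q \<equiv> int CARD('a :: {field, finite})"
  defines "L \<equiv> int (card (hankel_mats l m h (min l m) :: 'a mat set))"
  shows "min l m - 1 \<le> min h (n + 1 - h) \<Longrightarrow> L = q ^ (l + m - h - 1) - q ^ (min l m - 1)"
    and "h + 1 \<le> min l m - 1 \<Longrightarrow> L = q ^ (l + m - h - 1) - q ^ (2 * min l m - h - 2)"
    and "\<not> min l m - 1 \<le> min h (n + 1 - h) \<Longrightarrow> \<not> h + 1 \<le> min l m - 1 \<Longrightarrow> L = 0"
proof -
  define k where "k = min l m - 1"
  have min_le: "k < n1 n" "2 * min l m - h - 2 = 2 * k - h" using lm by (auto simp: n1_def k_def)
  have total: "l + m - h - 1 = n + 1 - h" using lm by auto
  have "L + int (card (hankel_tuples_le n h k :: 'a vec set)) = q ^ (n + 1 - h)"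
    using card_hankel_mats(2)[OF lm h refl, where 'a = 'a] unfolding L_def q_def k_def
    by (simp flip: of_nat_add of_nat_power)
  then have L: "L = q ^ (n + 1 - h) - q ^ (if h \<le> k then 2 * k - h else min k (n + 1 - h))"
    using min_le unfolding card_hankel_tuples_le[OF h] q_def by simp
  show "L = q ^ (l + m - h - 1) - q ^ (min l m - 1)" if "min l m - 1 \<le> min h (n + 1 - h)"
  proof -
    have "(if h \<le> k then 2 * k - h else min k (n + 1 - h)) = k"
      using that unfolding k_def[symmetric] by (cases "h \<le> k") auto
    then show ?thesis unfolding L total k_def[symmetric] by simp
  qed
  show "L = q ^ (l + m - h - 1) - q ^ (2 * min l m - h - 2)" if "h + 1 \<le> min l m - 1"
    using that unfolding L total min_le(2) k_def[symmetric] by simp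
  show "L = 0" if "\<not> min l m - 1 \<le> min h (n + 1 - h)" "\<not> h + 1 \<le> min l m - 1"
  proof -
    have "(if h \<le> k then 2 * k - h else min k (n + 1 - h)) = n + 1 - h"
      using that min_le(1) h unfolding k_def[symmetric] by (auto simp: n1_def)
    then show ?thesis unfolding L by simp
  qed
qed

section \<open>The classification\<close>

theorem theorem2p3p1:
  fixes q n h :: nat
  assumes q: "q = card (UNIV :: 'a :: {field, finite} set)"
    and h: "h \<le> n + 1"
  shows
    "(\<forall>r.
        ((hankel_tuples_rho_pi n h r 0 r :: 'a vec set) \<noteq> {} \<longrightarrow>
           (even n \<longrightarrow> r \<le> n1 n - 1) \<and> (odd n \<longrightarrow> r \<le> n1 n) \<and> r \<le> n + 1 - h) \<and>
        ((even n \<longrightarrow> r \<le> n1 n - 1) \<and> (odd n \<longrightarrow> r \<le> n1 n) \<and> r \<le> n + 1 - h \<longrightarrow>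
           (r = 0 \<longrightarrow> card (hankel_tuples_rho_pi n h r 0 r :: 'a vec set) = 1) \<and>
           (r > 0 \<longrightarrow>
              int (card (hankel_tuples_rho_pi n h r 0 r :: 'a vec set))
                = (int q - 1) * int q ^ (r - 1))))
     \<and>
     (\<forall>\<rho>\<^sub>1\<in>{1..n1 n - 1}. \<forall>\<pi>\<^sub>1.
        ((hankel_tuples_rho_pi n h (\<rho>\<^sub>1 + \<pi>\<^sub>1) \<rho>\<^sub>1 \<pi>\<^sub>1 :: 'a vec set) \<noteq> {} \<longrightarrow>
           (even n \<longrightarrow> \<pi>\<^sub>1 \<le> n1 n - \<rho>\<^sub>1 - 1) \<and> (odd n \<longrightarrow> \<pi>\<^sub>1 \<le> n1 n - \<rho>\<^sub>1) \<and> \<rho>\<^sub>1 \<ge> h + 1) \<and>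
        ((even n \<longrightarrow> \<pi>\<^sub>1 \<le> n1 n - \<rho>\<^sub>1 - 1) \<and> (odd n \<longrightarrow> \<pi>\<^sub>1 \<le> n1 n - \<rho>\<^sub>1) \<and> \<rho>\<^sub>1 \<ge> h + 1 \<longrightarrow>
           (\<pi>\<^sub>1 = 0 \<longrightarrow>
              int (card (hankel_tuples_rho_pi n h (\<rho>\<^sub>1 + \<pi>\<^sub>1) \<rho>\<^sub>1 \<pi>\<^sub>1 :: 'a vec set))
                = (int q - 1) * int q ^ (2 * \<rho>\<^sub>1 - h - 1)) \<and>
           (\<pi>\<^sub>1 > 0 \<longrightarrow>
              int (card (hankel_tuples_rho_pi n h (\<rho>\<^sub>1 + \<pi>\<^sub>1) \<rho>\<^sub>1 \<pi>\<^sub>1 :: 'a vec set))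
                = (int q - 1)\<^sup>2 * int q ^ (2 * \<rho>\<^sub>1 + \<pi>\<^sub>1 - h - 2))))
     \<and>
     ((\<forall>r \<pi>\<^sub>1. (hankel_tuples_rho_pi n h r (n1 n) \<pi>\<^sub>1 :: 'a vec set) \<noteq> {} \<longrightarrow>
         r = n1 n \<and> \<pi>\<^sub>1 = 0 \<and> h + 1 \<le> n1 n) \<and>
      (h + 1 \<le> n1 n \<longrightarrow>
         int (card (hankel_tuples_rho_pi n h (n1 n) (n1 n) 0 :: 'a vec set))
           = (int q - 1) * int q ^ (n - h)))
     \<and>
     (\<forall>r.
        (r = 0 \<longrightarrow> card (hankel_tuples n h r :: 'a vec set) = 1) \<and>
        (1 \<le> r \<and> r \<le> min h (n + 1 - h) \<longrightarrow>
           int (card (hankel_tuples n h r :: 'a vec set)) = (int q - 1) * int q ^ (r - 1)) \<and>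
        (h + 1 \<le> r \<and> r \<le> n1 n - 1 \<longrightarrow>
           int (card (hankel_tuples n h r :: 'a vec set))
             = ((int q)\<^sup>2 - 1) * int q ^ (2 * r - h - 2)) \<and>
        (r = n1 n \<and> h + 1 \<le> n1 n \<longrightarrow>
           int (card (hankel_tuples n h r :: 'a vec set))
             = int q ^ (n + 1 - h) - int q ^ (2 * n1 n - h - 2)) \<and>
        (\<not> (r = 0 \<or> (1 \<le> r \<and> r \<le> min h (n + 1 - h)) \<or> (h + 1 \<le> r \<and> r \<le> n1 n - 1) \<or>
            (r = n1 n \<and> h + 1 \<le> n1 n)) \<longrightarrow>
           (hankel_tuples n h r :: 'a vec set) = {}))
     \<and>
     (\<forall>l m r. l \<ge> 1 \<and> m \<ge> 1 \<and> l + m - 2 = n \<longrightarrow>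
        (r < min l m \<longrightarrow>
           (r = 0 \<longrightarrow> card (hankel_mats l m h r :: 'a mat set) = 1) \<and>
           (1 \<le> r \<and> r \<le> min h (n + 1 - h) \<longrightarrow>
              int (card (hankel_mats l m h r :: 'a mat set)) = (int q - 1) * int q ^ (r - 1)) \<and>
           (h + 1 \<le> r \<and> r \<le> n1 n - 1 \<longrightarrow>
              int (card (hankel_mats l m h r :: 'a mat set))
                = ((int q)\<^sup>2 - 1) * int q ^ (2 * r - h - 2))) \<and>
        (r = min l m \<longrightarrow>
           (min l m - 1 \<le> min h (n + 1 - h) \<longrightarrow>
              int (card (hankel_mats l m h r :: 'a mat set))
                = int q ^ (l + m - h - 1) - int q ^ (min l m - 1)) \<and>
           (min l m - 1 \<ge> h + 1 \<longrightarrow>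
              int (card (hankel_mats l m h r :: 'a mat set))
                = int q ^ (l + m - h - 1) - int q ^ (2 * min l m - h - 2))) \<and>
        (\<not> (r < min l m \<and>
              (r = 0 \<or> (1 \<le> r \<and> r \<le> min h (n + 1 - h)) \<or> (h + 1 \<le> r \<and> r \<le> n1 n - 1)) \<or>
            r = min l m \<and> (min l m - 1 \<le> min h (n + 1 - h) \<or> min l m - 1 \<ge> h + 1)) \<longrightarrow>
           (hankel_mats l m h r :: 'a mat set) = {}))"
proof -
  have q_minus_1: "int q - 1 = int (CARD('a) - 1)"
    using one_less_card_field[where 'a = 'a] by (simp add: q of_nat_diff)
  have card_tuples_0: "hankel_tuples n h r = ({} :: 'a vec set)"
    if "int (card (hankel_tuples n h r :: 'a vec set)) = 0" for r
    using that by simp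
  note zero_rho = hankel_tuples_rho_zero_nonempty[OF _ h, where 'a = 'a]
    card_hankel_tuples_rho_zero[OF _ _ h, where 'a = 'a]
  note rank_counts = card_hankel_tuples_formula[OF h, where 'a = 'a, folded q]
  note parity = parity_bound_iff[where n = n]
  have parity_0: "(even n \<longrightarrow> r \<le> n1 n - 1) \<and> (odd n \<longrightarrow> r \<le> n1 n) \<longleftrightarrow> r \<le> n + 1 - n1 n" for r
    using parity[of 0 r] n1_bounds(1)[of n] by simp
  show ?thesis
  (* The goals come in the order of the statement: 1 to 5 for \<rho> = 0, 6 to 10 for 0 < \<rho> < n_1, 11 to 14
     for \<rho> = n_1, 15 to 19 for the rank alone, 20 to 25 for the matrices of a given shape. *)
  proof (intro conjI allI impI ballI, goal_cases)
    case (1 r) then show ?case using zero_rho(1) parity_0 by blast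
  next
    case (2 r) then show ?case using zero_rho(1) parity_0 by blast
  next
    case (3 r) then show ?case using zero_rho(2) by blast
  next
    case (4 r) then show ?case using zero_rho(3)[of r] parity_0[of r] by auto
  next
    case (5 r) then show ?case using zero_rho(3)[of r] parity_0[of r] by (auto simp: q_minus_1 q)
  next
    case (6 \<rho> \<pi>)
    then have "\<rho> < n1 n" using n1_bounds(1)[of n] by auto
    with 6 show ?case using hankel_tuples_rho_pi_rank_le[of n h \<rho> \<pi>] parity by blast
  next
    case (7 \<rho> \<pi>)
    then have "\<rho> < n1 n" using n1_bounds(1)[of n] by auto
    with 7 show ?case using hankel_tuples_rho_pi_rank_le[of n h \<rho> \<pi>] parity by blast
  next
    case (8 \<rho> \<pi>) then show ?case using hankel_tuples_rho_pos_nonempty[of n h \<rho> \<pi>, where 'a = 'a] by auto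
  next
    case (9 \<rho> \<pi>)
    then have "\<rho> < n1 n" using n1_bounds(1)[of n] by auto
    with 9 show ?case
      using card_hankel_tuples_rho_pos[of \<rho> n \<pi> h, where 'a = 'a] parity[of \<rho> \<pi>] by (auto simp: q_minus_1 q)
  next
    case (10 \<rho> \<pi>)
    then have "\<rho> < n1 n" using n1_bounds(1)[of n] by auto
    with 10 show ?case
      using card_hankel_tuples_rho_pos[of \<rho> n \<pi> h, where 'a = 'a] parity[of \<rho> \<pi>] by (auto simp: q_minus_1 q)
  next
    case (11 r \<pi>) then show ?case using hankel_tuples_rho_max_nonempty by blast
  next
    case (12 r \<pi>) then show ?case using hankel_tuples_rho_max_nonempty by blast
  next
    case (13 r \<pi>) then show ?case using hankel_tuples_rho_max_nonempty by blast
  next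
    case 14 then show ?case
      using card_hankel_tuples_rho_max[of h n, where 'a = 'a] by (auto simp: q_minus_1 q)
  next
    case (15 r) then show ?case using rank_counts(1)[of r] by simp
  next
    case (16 r) then show ?case using rank_counts(2)[of r] by simp
  next
    case (17 r) then show ?case using rank_counts(3)[of r] by simp
  next
    case (18 r) then show ?case using rank_counts(4)[of r] by simp
  next
    case (19 r) show ?case by (rule card_tuples_0[OF rank_counts(5)[OF 19]])
  next
    case (20 l m r)
    then show ?case using card_hankel_mats(1)[OF _ _ _ h, of l m r, where 'a = 'a] rank_counts(1)[of r] by simp
  next
    case (21 l m r)
    then show ?case using card_hankel_mats(1)[OF _ _ _ h, of l m r, where 'a = 'a] rank_counts(2)[of r] by simp
  next
    case (22 l m r)
    then show ?case using card_hankel_mats(1)[OF _ _ _ h, of l m r, where 'a = 'a] rank_counts(3)[of r] by simp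
  next
    case (23 l m r)
    then show ?case using card_hankel_mats_full_rank(1)[OF _ _ _ h, of l m, where 'a = 'a] by (simp add: q)
  next
    case (24 l m r)
    then show ?case using card_hankel_mats_full_rank(2)[OF _ _ _ h, of l m, where 'a = 'a] by (simp add: q)
  next
    case (25 l m r)
    then have lm: "1 \<le> l" "1 \<le> m" "l + m - 2 = n" by auto
    consider "r < min l m" | "r = min l m" | "min l m < r" by linarith
    then show ?case
    proof cases
      case 1
      then have "r < n1 n" using lm by (auto simp: n1_def)
      then have "int (card (hankel_tuples n h r :: 'a vec set)) = 0"
        using 1 25 by (intro rank_counts(5)) auto
      then show ?thesis
        using card_hankel_mats(1,4)[OF lm h, of r, where 'a = 'a] 1 by simp
    next
      case 2
      then have "int (card (hankel_mats l m h r :: 'a mat set)) = 0"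
        using card_hankel_mats_full_rank(3)[OF lm h, where 'a = 'a] 25 by auto
      then show ?thesis using card_hankel_mats(4)[OF lm h, of r, where 'a = 'a] by simp
    next
      case 3
      then show ?thesis by (rule card_hankel_mats(3)[OF lm h])
    qed
  qed
qed

end
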